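(* Let $H\in(0,1)$ and $K\in(1,2)$ with $HK\in(0,1)$. Let $B^{HK}=(B^{HK}_t,\ t\ge 0)$ be a fractional Brownian motion with Hurst parameter $HK$ and let $W=\{W_t,\ t\ge 0\}$ be a standard Brownian motion, with $B^{HK}$ and $W$ independent. Let $X^{H,K}=(X^{H,K}_t,\ t\geq 0)$ be the process $$X^{H,K}_t=\int_0^{\infty}\left(1-e^{-r t^{2H}}\right)r^{-\frac{1+K}{2}}\,dW_r,\qquad t\ge 0 .$$ Set $a=\sqrt{2^{1-K}}$ and $b=\sqrt{\frac{K(K-1)}{2^K\Gamma(2-K)}}$. Then the process $$B^{H,K}_t=a B^{HK}_t+bX^{H,K}_t,\qquad t\ge 0,$$ is a centered Gaussian process with covariance function $$E\left(B^{H,K}_tB^{H,K}_s\right)=\frac{1}{2^K}\left(\left(t^{2H}+s^{2H}\right)^K-|t-s|^{2HK}\right),\qquad s,t\ge 0.$$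
   Context: A fractional Brownian motion with Hurst parameter $h\in(0,1)$ is a centered Gaussian process $(B^h_t)_{t\ge0}$ with covariance $E(B^h_tB^h_s)=\frac12\left(t^{2h}+s^{2h}-|t-s|^{2h}\right)$. The integral defining $X^{H,K}$ is the Wiener integral of a deterministic square-integrable function with respect to $W$. $\Gamma$ is the Gamma function. *)

theory Defs
  imports "HOL-Probability.Probability"
begin

text \<open>Constants count as (degenerate) Gaussian random variables.\<close>

definition gaussian_rv :: "'a measure \<Rightarrow> ('a \<Rightarrow> real) \<Rightarrow> bool" where
  "gaussian_rv M Y \<longleftrightarrow> Y \<in> borel_measurable M \<and>
     ((\<exists>\<mu>. AE \<omega> in M. Y \<omega> = \<mu>) \<or>
      (\<exists>\<mu> \<sigma>. 0 < \<sigma> \<and> distributed M lborel Y (\<lambda>x. ennreal (normal_density \<mu> \<sigma> x))))"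

definition gaussian_process :: "'a measure \<Rightarrow> real set \<Rightarrow> (real \<Rightarrow> 'a \<Rightarrow> real) \<Rightarrow> bool" where
  "gaussian_process M T X \<longleftrightarrow>
     (\<forall>F c. finite F \<and> F \<subseteq> T \<longrightarrow> gaussian_rv M (\<lambda>\<omega>. \<Sum>t\<in>F. c t * X t \<omega>))"

definition centered_gaussian_process :: "'a measure \<Rightarrow> real set \<Rightarrow> (real \<Rightarrow> 'a \<Rightarrow> real) \<Rightarrow> bool" where
  "centered_gaussian_process M T X \<longleftrightarrow>
     gaussian_process M T X \<and> (\<forall>t\<in>T. (\<integral>\<omega>. X t \<omega> \<partial>M) = 0)"

definition fractional_brownian_motion :: "'a measure \<Rightarrow> real \<Rightarrow> (real \<Rightarrow> 'a \<Rightarrow> real) \<Rightarrow> bool" where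
  "fractional_brownian_motion M h B \<longleftrightarrow> 0 < h \<and> h < 1 \<and>
     centered_gaussian_process M {0..} B \<and>
     (\<forall>s\<ge>0. \<forall>t\<ge>0. (\<integral>\<omega>. B t \<omega> * B s \<omega> \<partial>M) =
        1 / 2 * (t powr (2 * h) + s powr (2 * h) - \<bar>t - s\<bar> powr (2 * h)))"

definition standard_brownian_motion :: "'a measure \<Rightarrow> (real \<Rightarrow> 'a \<Rightarrow> real) \<Rightarrow> bool" where
  "standard_brownian_motion M W \<longleftrightarrow>
     (\<forall>t\<ge>0. W t \<in> borel_measurable M) \<and>
     (AE \<omega> in M. W 0 \<omega> = 0) \<and>
     (\<forall>n. \<forall>\<tau> :: nat \<Rightarrow> real. 0 \<le> \<tau> 0 \<and> (\<forall>i<n. \<tau> i < \<tau> (Suc i)) \<longrightarrow>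
        prob_space.indep_vars M (\<lambda>_. borel)
          (\<lambda>i \<omega>. W (\<tau> (Suc i)) \<omega> - W (\<tau> i) \<omega>) {..<n}) \<and>
     (\<forall>s t. 0 \<le> s \<and> s < t \<longrightarrow>
        distributed M lborel (\<lambda>\<omega>. W t \<omega> - W s \<omega>)
          (\<lambda>x. ennreal (normal_density 0 (sqrt (t - s)) x))) \<and>
     (AE \<omega> in M. continuous_on {0..} (\<lambda>t. W t \<omega>))"

text \<open>Independence of the whole families \<open>(X\<^sub>t)\<close> and \<open>(Y\<^sub>t)\<close>, \<open>t \<in> T\<close>, as random elements
  of the product space over \<open>T\<close>.\<close>

definition indep_processes ::
    "'a measure \<Rightarrow> real set \<Rightarrow> (real \<Rightarrow> 'a \<Rightarrow> real) \<Rightarrow> (real \<Rightarrow> 'a \<Rightarrow> real) \<Rightarrow> bool" where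
  "indep_processes M T X Y \<longleftrightarrow>
     prob_space.indep_var M
       (PiM T (\<lambda>_. borel)) (\<lambda>\<omega>. \<lambda>t\<in>T. X t \<omega>)
       (PiM T (\<lambda>_. borel)) (\<lambda>\<omega>. \<lambda>t\<in>T. Y t \<omega>)"

text \<open>A list of triples \<open>(u, v, c)\<close> encodes the step function that is the sum of the
  \<open>c * 1\<^bsub>(u,v]\<^esub>\<close>; the intervals may overlap. The Wiener integral extends
  \<open>1\<^bsub>(u,v]\<^esub> \<mapsto> W\<^sub>v - W\<^sub>u\<close> by linearity and continuity in \<open>L\<^sup>2\<close>.\<close>

definition step_fun :: "(real \<times> real \<times> real) list \<Rightarrow> real \<Rightarrow> real" where
  "step_fun P r = (\<Sum>(u, v, c)\<leftarrow>P. c * indicator {u<..v} r)"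

definition step_integral :: "(real \<Rightarrow> 'a \<Rightarrow> real) \<Rightarrow> (real \<times> real \<times> real) list \<Rightarrow> 'a \<Rightarrow> real" where
  "step_integral W P \<omega> = (\<Sum>(u, v, c)\<leftarrow>P. c * (W v \<omega> - W u \<omega>))"

definition has_wiener_integral ::
    "'a measure \<Rightarrow> (real \<Rightarrow> 'a \<Rightarrow> real) \<Rightarrow> (real \<Rightarrow> real) \<Rightarrow> ('a \<Rightarrow> real) \<Rightarrow> bool" where
  "has_wiener_integral M W f I \<longleftrightarrow>
     set_borel_measurable lborel {0..} f \<and>
     set_integrable lborel {0..} (\<lambda>r. (f r)\<^sup>2) \<and>
     I \<in> borel_measurable M \<and>
     (\<exists>P :: nat \<Rightarrow> (real \<times> real \<times> real) list.
        (\<forall>n. \<forall>(u, v, c)\<in>set (P n). 0 \<le> u \<and> u \<le> v) \<and>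
        (\<lambda>n. \<integral>\<^sup>+ r\<in>{0..}. ennreal ((f r - step_fun (P n) r)\<^sup>2) \<partial>lborel) \<longlonglongrightarrow> 0 \<and>
        (\<lambda>n. \<integral>\<^sup>+ \<omega>. ennreal ((I \<omega> - step_integral W (P n) \<omega>)\<^sup>2) \<partial>M) \<longlonglongrightarrow> 0)"

text \<open>For a Brownian motion \<open>W\<close> and square-integrable \<open>f\<close> the integral exists and is unique
  up to almost sure equality, so statements about \<open>wiener_integral\<close> should be almost sure ones.\<close>

definition wiener_integral ::
    "'a measure \<Rightarrow> (real \<Rightarrow> 'a \<Rightarrow> real) \<Rightarrow> (real \<Rightarrow> real) \<Rightarrow> 'a \<Rightarrow> real" where
  "wiener_integral M W f = (SOME I. has_wiener_integral M W f I)"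

end

theory Submission
  imports Defs
begin

text \<open>
  By independence, the covariance of \<open>a B + b X\<close> is \<open>a\<^sup>2\<close> times that
  of the fractional Brownian motion plus \<open>b\<^sup>2\<close> times that of \<open>X\<close>. With \<open>x = t powr (2 * H)\<close> and
  \<open>y = s powr (2 * H)\<close>, the first contributes
  \<open>(x powr K + y powr K - \<bar>t - s\<bar> powr (2 * H * K)) / 2 powr K\<close>. The Wiener isometry turns the second
  into the integral of \<open>(1 - exp (- r x)) (1 - exp (- r y)) r powr (- 1 - K)\<close> over \<open>r > 0\<close>. Writing
  each factor \<open>1 - exp (- r x)\<close> as the integral of \<open>r exp (- r u)\<close> over \<open>0 \<le> u \<le> x\<close> and
  exchanging the order of integration gives first a Gamma integral in \<open>r\<close>, then a double integral
  of \<open>(u + v) powr (K - 2)\<close>, and the value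
  \<open>\<Gamma>(2 - K) / (K (K - 1)) * ((x + y) powr K - x powr K - y powr K)\<close>
  (\<open>has_bochner_integral_kern_mult\<close>). The constant \<open>b\<close> is chosen so that the powers \<open>x powr K\<close> and
  \<open>y powr K\<close> cancel in the sum.

  Gaussianity is handled through characteristic functions: a centred law is normal with variance
  \<open>v\<close> exactly when its characteristic function is \<open>s \<mapsto> exp (- v s\<^sup>2 / 2)\<close>, by Levy's uniqueness
  theorem. This description is stable under independent sums and under limits in mean square.
  The integral of a step function is a combination of independent increments, hence normal with
  variance the squared \<open>L\<^sup>2\<close> norm (\<open>centered_normal_step_integral\<close>); since step functions are
  closed under linear combinations, both facts pass to Wiener integrals, to their linear
  combinations, and to their sums with an independent Gaussian variable
  (\<open>wiener_integral_law\<close>). Covariances then follow by polarization.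

  Finally, \<open>wiener_integral\<close> is defined by choice, so it has to be shown that an integral exists. The
  integrand decreases on the positive half line, so its values at right end points of a grid give
  step functions below it, and they converge in \<open>L\<^sup>2\<close> by dominated convergence; the isometry
  makes their integrals a Cauchy sequence in mean square, which converges
  (\<open>L2_complete_geometric\<close>).
\<close>

section \<open>Centred normal laws and their characteristic functions\<close>

text \<open>Specifying the law by its characteristic function puts the degenerate case \<open>v = 0\<close> and the
  case with a density on the same footing.\<close>

definition centered_normal :: "'a measure \<Rightarrow> ('a \<Rightarrow> real) \<Rightarrow> real \<Rightarrow> bool" where
  "centered_normal M Y v \<longleftrightarrow> Y \<in> borel_measurable M \<and> 0 \<le> v \<and>
     (\<forall>s. char (distr M borel Y) s = exp (- (v * s\<^sup>2 / 2)))"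

lemma char_distr:
  assumes "Y \<in> borel_measurable M"
  shows "char (distr M borel Y) s = (CLINT \<omega>|M. iexp (s * Y \<omega>))"
  unfolding char_def using assms by (subst integral_distr) auto

lemma char_distr_cmult:
  assumes "Y \<in> borel_measurable M"
  shows "char (distr M borel (\<lambda>\<omega>. c * Y \<omega>)) s = char (distr M borel Y) (s * c)"
  using assms by (simp add: char_distr mult.assoc)

lemma distributed_std_normal_imp_distr:
  assumes "distributed M lborel Z std_normal_density"
  shows "distr M borel Z = std_normal_distribution"
proof -
  have "distr M borel Z = distr M lborel Z" by (rule distr_cong) auto
  also have "\<dots> = std_normal_distribution" using assms by (simp add: distributed_def)
  finally show ?thesis .
qed

context prob_space
begin

lemma centered_normal_distributed:
  assumes \<sigma>: "0 < \<sigma>" and D: "distributed M lborel Y (normal_density 0 \<sigma>)"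
  shows "centered_normal M Y (\<sigma>\<^sup>2)" "integrable M Y" "expectation Y = 0"
    "integrable M (\<lambda>\<omega>. (Y \<omega>)\<^sup>2)" "expectation (\<lambda>\<omega>. (Y \<omega>)\<^sup>2) = \<sigma>\<^sup>2"
proof -
  have Y[measurable]: "Y \<in> borel_measurable M"
    using distributed_measurable[OF D] by simp
  have Z: "distributed M lborel (\<lambda>x. (Y x - 0) / \<sigma>) std_normal_density"
    using normal_standard_normal_convert[OF \<sigma>] D by blast
  have "char (distr M borel Y) s = exp (- (\<sigma>\<^sup>2 * s\<^sup>2 / 2))" for s
  proof -
    have "char (distr M borel Y) s = char (distr M borel (\<lambda>x. \<sigma> * ((Y x - 0) / \<sigma>))) s"
      using \<sigma> by simp
    also have "\<dots> = char (distr M borel (\<lambda>x. (Y x - 0) / \<sigma>)) (s * \<sigma>)"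
      by (rule char_distr_cmult) simp
    also have "\<dots> = exp (- (\<sigma>\<^sup>2 * s\<^sup>2 / 2))"
      unfolding distributed_std_normal_imp_distr[OF Z] char_std_normal_distribution
      by (simp add: power_mult_distrib mult.commute)
    finally show ?thesis .
  qed
  then show "centered_normal M Y (\<sigma>\<^sup>2)" by (simp add: centered_normal_def)
  show E: "expectation Y = 0" by (rule normal_distributed_expectation[OF \<sigma> D])
  show "integrable M Y"
    using distributed_integrable[OF D, of "\<lambda>x. x"] integrable_normal_moment_nz_1[OF \<sigma>, of 0]
    by simp
  show "integrable M (\<lambda>\<omega>. (Y \<omega>)\<^sup>2)"
    using distributed_integrable[OF D, of "\<lambda>x. x\<^sup>2"] integrable_normal_moment[OF \<sigma>, of 0 2]
    by simp
  show "expectation (\<lambda>\<omega>. (Y \<omega>)\<^sup>2) = \<sigma>\<^sup>2"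
    using normal_distributed_variance[OF \<sigma> D] by (simp add: E)
qed

lemma centered_normal_zero:
  assumes "AE \<omega> in M. Y \<omega> = 0" and [measurable]: "Y \<in> borel_measurable M"
  shows "centered_normal M Y 0"
proof -
  have "(CLINT \<omega>|M. iexp (s * Y \<omega>)) = (CLINT \<omega>|M. 1)" for s
    by (rule integral_cong_AE) (use assms in auto)
  then show ?thesis by (simp add: centered_normal_def char_distr prob_space)
qed

text \<open>A Gaussian variable is either almost surely constant, and then the constant is its mean
  zero, or has a normal density whose location parameter is its mean zero.\<close>

lemma gaussian_rv_imp_centered_normal:
  assumes G: "gaussian_rv M Y" and E: "expectation Y = 0"
  shows "centered_normal M Y (expectation (\<lambda>\<omega>. (Y \<omega>)\<^sup>2))"
    and "integrable M Y" and "integrable M (\<lambda>\<omega>. (Y \<omega>)\<^sup>2)"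
proof -
  have Y[measurable]: "Y \<in> borel_measurable M" using G by (simp add: gaussian_rv_def)
  have "centered_normal M Y (expectation (\<lambda>\<omega>. (Y \<omega>)\<^sup>2)) \<and> integrable M Y
      \<and> integrable M (\<lambda>\<omega>. (Y \<omega>)\<^sup>2)"
  proof (cases "\<exists>\<mu>. AE \<omega> in M. Y \<omega> = \<mu>")
    case True
    then obtain \<mu> where \<mu>: "AE \<omega> in M. Y \<omega> = \<mu>" by blast
    have "expectation Y = expectation (\<lambda>_. \<mu>)" by (rule integral_cong_AE) (use \<mu> in auto)
    with E have "\<mu> = 0" by (simp add: prob_space)
    with \<mu> have z: "AE \<omega> in M. Y \<omega> = 0" by simp
    have "expectation (\<lambda>\<omega>. (Y \<omega>)\<^sup>2) = 0" by (rule integral_eq_zero_AE) (use z in auto)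
    moreover have "integrable M Y \<longleftrightarrow> integrable M (\<lambda>_. 0 :: real)"
      by (rule integrable_cong_AE) (use z in auto)
    moreover have "integrable M (\<lambda>\<omega>. (Y \<omega>)\<^sup>2) \<longleftrightarrow> integrable M (\<lambda>_. 0 :: real)"
      by (rule integrable_cong_AE) (use z in auto)
    ultimately show ?thesis using centered_normal_zero[OF z Y] by simp
  next
    case False
    with G obtain \<mu> \<sigma> where \<sigma>: "0 < \<sigma>" and D: "distributed M lborel Y (normal_density \<mu> \<sigma>)"
      unfolding gaussian_rv_def by blast
    have "\<mu> = 0" using normal_distributed_expectation[OF \<sigma> D] E by simp
    with centered_normal_distributed[OF \<sigma>] D show ?thesis by metis
  qed
  then show "centered_normal M Y (expectation (\<lambda>\<omega>. (Y \<omega>)\<^sup>2))"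
    and "integrable M Y" and "integrable M (\<lambda>\<omega>. (Y \<omega>)\<^sup>2)" by auto
qed

text \<open>By Levy's uniqueness theorem the characteristic function determines the law: it is the point
  mass at \<open>0\<close> for \<open>v = 0\<close>, and otherwise \<open>Y / sqrt v\<close> is standard normal.\<close>

lemma centered_normal_imp_gaussian_rv:
  assumes C: "centered_normal M Y v"
  shows "gaussian_rv M Y" and "expectation Y = 0"
    and "integrable M (\<lambda>\<omega>. (Y \<omega>)\<^sup>2)" and "expectation (\<lambda>\<omega>. (Y \<omega>)\<^sup>2) = v"
proof -
  have Y[measurable]: "Y \<in> borel_measurable M" and v: "0 \<le> v"
    and ch: "\<And>s. char (distr M borel Y) s = exp (- (v * s\<^sup>2 / 2))"
    using C by (auto simp: centered_normal_def)
  have rdY: "real_distribution (distr M borel Y)" by simp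
  have "gaussian_rv M Y \<and> expectation Y = 0 \<and> integrable M (\<lambda>\<omega>. (Y \<omega>)\<^sup>2)
      \<and> expectation (\<lambda>\<omega>. (Y \<omega>)\<^sup>2) = v"
  proof (cases "v = 0")
    case True
    have "char (distr M borel Y) = char (distr M borel (\<lambda>_. 0))"
      using True by (intro ext) (simp add: ch char_distr prob_space del: distr_const)
    then have eq: "distr M borel Y = distr M borel (\<lambda>_. 0)"
      by (intro Levy_uniqueness) (auto simp del: distr_const)
    have "AE x in distr M borel Y. x = 0" unfolding eq by (subst AE_distr_iff) auto
    then have z: "AE \<omega> in M. Y \<omega> = 0" by (subst (asm) AE_distr_iff) auto
    have "expectation (\<lambda>\<omega>. (Y \<omega>)\<^sup>2) = 0" by (rule integral_eq_zero_AE) (use z in auto)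
    moreover have "expectation Y = 0" by (rule integral_eq_zero_AE) (use z in auto)
    moreover have "integrable M (\<lambda>\<omega>. (Y \<omega>)\<^sup>2) \<longleftrightarrow> integrable M (\<lambda>_. 0 :: real)"
      by (rule integrable_cong_AE) (use z in auto)
    ultimately show ?thesis using z True by (auto simp: gaussian_rv_def)
  next
    case False
    define \<sigma> where "\<sigma> = sqrt v"
    have \<sigma>: "0 < \<sigma>" "\<sigma>\<^sup>2 = v" using False v by (auto simp: \<sigma>_def)
    have "char (distr M borel (\<lambda>\<omega>. (Y \<omega> - 0) / \<sigma>)) s = char std_normal_distribution s" for s
    proof -
      have "char (distr M borel (\<lambda>\<omega>. (Y \<omega> - 0) / \<sigma>)) s
          = char (distr M borel (\<lambda>\<omega>. (1 / \<sigma>) * Y \<omega>)) s" by simp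
      also have "\<dots> = char (distr M borel Y) (s * (1 / \<sigma>))" by (rule char_distr_cmult) simp
      also have "\<dots> = char std_normal_distribution s"
        using \<sigma> False by (simp add: ch char_std_normal_distribution power_divide)
      finally show ?thesis .
    qed
    then have "distr M borel (\<lambda>\<omega>. (Y \<omega> - 0) / \<sigma>) = std_normal_distribution"
      by (intro Levy_uniqueness real_dist_normal_dist ext) auto
    moreover have "distr M lborel (\<lambda>\<omega>. (Y \<omega> - 0) / \<sigma>) = distr M borel (\<lambda>\<omega>. (Y \<omega> - 0) / \<sigma>)"
      by (rule distr_cong) auto
    ultimately have "distributed M lborel (\<lambda>\<omega>. (Y \<omega> - 0) / \<sigma>) std_normal_density"
      by (simp add: distributed_def)
    then have D: "distributed M lborel Y (normal_density 0 \<sigma>)"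
      using normal_standard_normal_convert[OF \<sigma>(1)] by blast
    then show ?thesis
      using centered_normal_distributed[OF \<sigma>(1) D] \<sigma> by (auto simp: gaussian_rv_def)
  qed
  then show "gaussian_rv M Y" and "expectation Y = 0"
    and "integrable M (\<lambda>\<omega>. (Y \<omega>)\<^sup>2)" and "expectation (\<lambda>\<omega>. (Y \<omega>)\<^sup>2) = v" by auto
qed

end

section \<open>Convergence in mean square\<close>

text \<open>The Cauchy-Schwarz inequality for the Lebesgue integral, together with integrability of the
  product.\<close>

lemma integral_mult_le_sqrt:
  fixes f g :: "'a \<Rightarrow> real"
  assumes [measurable]: "f \<in> borel_measurable N" "g \<in> borel_measurable N"
    and f: "integrable N (\<lambda>x. (f x)\<^sup>2)" and g: "integrable N (\<lambda>x. (g x)\<^sup>2)"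
  shows "integrable N (\<lambda>x. f x * g x)"
    and "(\<integral>x. \<bar>f x * g x\<bar> \<partial>N) \<le> sqrt (\<integral>x. (f x)\<^sup>2 \<partial>N) * sqrt (\<integral>x. (g x)\<^sup>2 \<partial>N)"
proof -
  have le: "\<bar>f x * g x\<bar> \<le> (f x)\<^sup>2 + (g x)\<^sup>2" for x
  proof -
    have "0 \<le> (\<bar>f x\<bar> - \<bar>g x\<bar>)\<^sup>2" by simp
    then have "2 * \<bar>f x * g x\<bar> \<le> (f x)\<^sup>2 + (g x)\<^sup>2"
      by (simp add: power2_diff abs_mult)
    then show ?thesis by linarith
  qed
  show fg: "integrable N (\<lambda>x. f x * g x)"
    by (rule Bochner_Integration.integrable_bound[OF Bochner_Integration.integrable_add[OF f g]])
      (use le in auto)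
  have "ennreal ((\<integral>x. \<bar>f x * g x\<bar> \<partial>N)\<^sup>2) = (\<integral>\<^sup>+x. ennreal \<bar>f x\<bar> * ennreal \<bar>g x\<bar> \<partial>N)\<^sup>2"
    using nn_integral_eq_integral[of N "\<lambda>x. \<bar>f x * g x\<bar>"] integrable_abs[OF fg]
    by (simp add: ennreal_power[symmetric] abs_mult ennreal_mult)
  also have "\<dots> \<le> (\<integral>\<^sup>+x. (ennreal \<bar>f x\<bar>)\<^sup>2 \<partial>N) * (\<integral>\<^sup>+x. (ennreal \<bar>g x\<bar>)\<^sup>2 \<partial>N)"
    by (rule Cauchy_Schwarz_nn_integral) auto
  also have "\<dots> = ennreal ((\<integral>x. (f x)\<^sup>2 \<partial>N) * (\<integral>x. (g x)\<^sup>2 \<partial>N))"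
    using f g by (simp add: ennreal_power nn_integral_eq_integral ennreal_mult)
  finally have "(\<integral>x. \<bar>f x * g x\<bar> \<partial>N)\<^sup>2 \<le> (\<integral>x. (f x)\<^sup>2 \<partial>N) * (\<integral>x. (g x)\<^sup>2 \<partial>N)"
    by (subst (asm) ennreal_le_iff) auto
  then have "\<bar>\<integral>x. \<bar>f x * g x\<bar> \<partial>N\<bar> \<le> sqrt ((\<integral>x. (f x)\<^sup>2 \<partial>N) * (\<integral>x. (g x)\<^sup>2 \<partial>N))"
    by (metis real_sqrt_abs real_sqrt_le_mono)
  then show "(\<integral>x. \<bar>f x * g x\<bar> \<partial>N) \<le> sqrt (\<integral>x. (f x)\<^sup>2 \<partial>N) * sqrt (\<integral>x. (g x)\<^sup>2 \<partial>N)"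
    by (simp add: real_sqrt_mult)
qed

lemma integral_add_square:
  fixes f g :: "'a \<Rightarrow> real"
  assumes "f \<in> borel_measurable N" "g \<in> borel_measurable N"
    and "integrable N (\<lambda>x. (f x)\<^sup>2)" "integrable N (\<lambda>x. (g x)\<^sup>2)"
  shows "(\<integral>x. (f x + g x)\<^sup>2 \<partial>N) = (\<integral>x. (f x)\<^sup>2 \<partial>N) + (\<integral>x. (g x)\<^sup>2 \<partial>N) + 2 * (\<integral>x. f x * g x \<partial>N)"
  using assms integral_mult_le_sqrt(1)[OF assms] by (simp add: power2_sum mult.assoc)

text \<open>Mean square limits preserve square integrability and second moments; the latter because
  \<open>g\<^sup>2 - f\<^sup>2 = (f - g)\<^sup>2 - 2 f (f - g)\<close> and the Cauchy-Schwarz inequality bounds the last term.\<close>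

lemma L2_limit:
  fixes f :: "'a \<Rightarrow> real" and g :: "nat \<Rightarrow> 'a \<Rightarrow> real"
  assumes [measurable]: "f \<in> borel_measurable N" "\<And>n. g n \<in> borel_measurable N"
    and g: "\<And>n. integrable N (\<lambda>x. (g n x)\<^sup>2)"
    and lim: "(\<lambda>n. \<integral>\<^sup>+x. ennreal ((f x - g n x)\<^sup>2) \<partial>N) \<longlonglongrightarrow> 0"
  shows "integrable N (\<lambda>x. (f x)\<^sup>2)"
    and "(\<lambda>n. \<integral>x. (g n x)\<^sup>2 \<partial>N) \<longlonglongrightarrow> (\<integral>x. (f x)\<^sup>2 \<partial>N)"
    and "\<And>n. integrable N (\<lambda>x. (f x - g n x)\<^sup>2)"
    and "(\<lambda>n. \<integral>x. (f x - g n x)\<^sup>2 \<partial>N) \<longlonglongrightarrow> 0"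
proof -
  have "eventually (\<lambda>n. (\<integral>\<^sup>+x. ennreal ((f x - g n x)\<^sup>2) \<partial>N) < 1) sequentially"
    by (rule order_tendstoD(2)[OF lim]) simp
  then obtain m where m: "(\<integral>\<^sup>+x. ennreal ((f x - g m x)\<^sup>2) \<partial>N) < 1"
    using eventually_happens by fastforce
  then have im: "integrable N (\<lambda>x. (f x - g m x)\<^sup>2)"
    by (intro integrableI_bounded) (auto intro: less_trans simp: ennreal_1[symmetric] simp del: ennreal_1)
  show f: "integrable N (\<lambda>x. (f x)\<^sup>2)"
  proof (rule Bochner_Integration.integrable_bound)
    show "integrable N (\<lambda>x. 2 * (f x - g m x)\<^sup>2 + 2 * (g m x)\<^sup>2)" using im g by auto
    show "AE x in N. norm ((f x)\<^sup>2) \<le> norm (2 * (f x - g m x)\<^sup>2 + 2 * (g m x)\<^sup>2)"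
    proof (rule AE_I2)
      fix x
      have "0 \<le> (f x - 2 * g m x)\<^sup>2" by simp
      then have "(f x)\<^sup>2 \<le> 2 * (f x - g m x)\<^sup>2 + 2 * (g m x)\<^sup>2"
        by (simp add: power2_eq_square algebra_simps)
      then show "norm ((f x)\<^sup>2) \<le> norm (2 * (f x - g m x)\<^sup>2 + 2 * (g m x)\<^sup>2)" by simp
    qed
  qed simp
  have fg: "integrable N (\<lambda>x. f x * g n x)" for n
    by (rule integral_mult_le_sqrt) (use f g in auto)
  show d: "integrable N (\<lambda>x. (f x - g n x)\<^sup>2)" for n
    using f g fg by (simp add: power2_diff mult.assoc)
  have "(\<lambda>n. ennreal (\<integral>x. (f x - g n x)\<^sup>2 \<partial>N)) \<longlonglongrightarrow> ennreal 0"
    using lim d by (simp add: nn_integral_eq_integral)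
  then show D: "(\<lambda>n. \<integral>x. (f x - g n x)\<^sup>2 \<partial>N) \<longlonglongrightarrow> 0"
    by (subst (asm) tendsto_ennreal_iff) auto
  have "(\<lambda>n. (\<integral>x. (f x - g n x)\<^sup>2 \<partial>N)
      + 2 * (sqrt (\<integral>x. (f x)\<^sup>2 \<partial>N) * sqrt (\<integral>x. (f x - g n x)\<^sup>2 \<partial>N))) \<longlonglongrightarrow> 0 + 2 * (sqrt (\<integral>x. (f x)\<^sup>2 \<partial>N) * sqrt 0)"
    by (intro tendsto_intros D)
  then have bd: "(\<lambda>n. (\<integral>x. (f x - g n x)\<^sup>2 \<partial>N)
      + 2 * (sqrt (\<integral>x. (f x)\<^sup>2 \<partial>N) * sqrt (\<integral>x. (f x - g n x)\<^sup>2 \<partial>N))) \<longlonglongrightarrow> 0" by simp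
  have "(\<lambda>n. (\<integral>x. (g n x)\<^sup>2 \<partial>N) - (\<integral>x. (f x)\<^sup>2 \<partial>N)) \<longlonglongrightarrow> 0"
  proof (rule Lim_null_comparison[OF _ bd], rule always_eventually, rule allI)
    fix n
    have p: "integrable N (\<lambda>x. f x * (f x - g n x))"
      using f fg by (simp add: algebra_simps power2_eq_square)
    have "(\<integral>x. (g n x)\<^sup>2 \<partial>N) = (\<integral>x. (f x)\<^sup>2 + (f x - g n x)\<^sup>2 - 2 * (f x * (f x - g n x)) \<partial>N)"
      by (rule Bochner_Integration.integral_cong) (auto simp: power2_eq_square algebra_simps)
    also have "\<dots> = (\<integral>x. (f x)\<^sup>2 \<partial>N) + (\<integral>x. (f x - g n x)\<^sup>2 \<partial>N) - 2 * (\<integral>x. f x * (f x - g n x) \<partial>N)"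
      using f d p by simp
    finally have e: "(\<integral>x. (g n x)\<^sup>2 \<partial>N) - (\<integral>x. (f x)\<^sup>2 \<partial>N)
        = (\<integral>x. (f x - g n x)\<^sup>2 \<partial>N) - 2 * (\<integral>x. f x * (f x - g n x) \<partial>N)" by simp
    have "\<bar>\<integral>x. f x * (f x - g n x) \<partial>N\<bar> \<le> (\<integral>x. \<bar>f x * (f x - g n x)\<bar> \<partial>N)"
      by (rule integral_abs_bound)
    also have "\<dots> \<le> sqrt (\<integral>x. (f x)\<^sup>2 \<partial>N) * sqrt (\<integral>x. (f x - g n x)\<^sup>2 \<partial>N)"
      by (rule integral_mult_le_sqrt) (use f d in auto)
    finally have le: "\<bar>\<integral>x. f x * (f x - g n x) \<partial>N\<bar>
        \<le> sqrt (\<integral>x. (f x)\<^sup>2 \<partial>N) * sqrt (\<integral>x. (f x - g n x)\<^sup>2 \<partial>N)" .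
    have "0 \<le> (\<integral>x. (f x - g n x)\<^sup>2 \<partial>N)" by simp
    with le show "norm ((\<integral>x. (g n x)\<^sup>2 \<partial>N) - (\<integral>x. (f x)\<^sup>2 \<partial>N)) \<le> (\<integral>x. (f x - g n x)\<^sup>2 \<partial>N)
      + 2 * (sqrt (\<integral>x. (f x)\<^sup>2 \<partial>N) * sqrt (\<integral>x. (f x - g n x)\<^sup>2 \<partial>N))"
      unfolding e real_norm_def by linarith
  qed
  then show "(\<lambda>n. \<integral>x. (g n x)\<^sup>2 \<partial>N) \<longlonglongrightarrow> (\<integral>x. (f x)\<^sup>2 \<partial>N)"
    by (simp add: Lim_null[symmetric])
qed

lemma L2_tendsto_add:
  fixes f g :: "'a \<Rightarrow> real"
  assumes [measurable]: "f \<in> borel_measurable N" "g \<in> borel_measurable N"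
    "\<And>n. F n \<in> borel_measurable N" "\<And>n. G n \<in> borel_measurable N"
    and f: "(\<lambda>n. \<integral>\<^sup>+x. ennreal ((f x - F n x)\<^sup>2) \<partial>N) \<longlonglongrightarrow> 0"
    and g: "(\<lambda>n. \<integral>\<^sup>+x. ennreal ((g x - G n x)\<^sup>2) \<partial>N) \<longlonglongrightarrow> 0"
  shows "(\<lambda>n. \<integral>\<^sup>+x. ennreal ((f x + g x - (F n x + G n x))\<^sup>2) \<partial>N) \<longlonglongrightarrow> 0"
proof -
  have "(\<lambda>n. 2 * (\<integral>\<^sup>+x. ennreal ((f x - F n x)\<^sup>2) \<partial>N) + 2 * (\<integral>\<^sup>+x. ennreal ((g x - G n x)\<^sup>2) \<partial>N))
      \<longlonglongrightarrow> 2 * 0 + 2 * 0"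
    by (intro tendsto_add ennreal_tendsto_cmult f g) auto
  then have bd: "(\<lambda>n. 2 * (\<integral>\<^sup>+x. ennreal ((f x - F n x)\<^sup>2) \<partial>N) + 2 * (\<integral>\<^sup>+x. ennreal ((g x - G n x)\<^sup>2) \<partial>N))
      \<longlonglongrightarrow> 0" by simp
  show ?thesis
  proof (rule tendsto_sandwich[OF _ _ tendsto_const bd])
    show "\<forall>\<^sub>F n in sequentially. (\<integral>\<^sup>+x. ennreal ((f x + g x - (F n x + G n x))\<^sup>2) \<partial>N)
      \<le> 2 * (\<integral>\<^sup>+x. ennreal ((f x - F n x)\<^sup>2) \<partial>N) + 2 * (\<integral>\<^sup>+x. ennreal ((g x - G n x)\<^sup>2) \<partial>N)"
    proof (intro always_eventually allI)
      fix n
      have "(\<integral>\<^sup>+x. ennreal ((f x + g x - (F n x + G n x))\<^sup>2) \<partial>N)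
          \<le> (\<integral>\<^sup>+x. 2 * ennreal ((f x - F n x)\<^sup>2) + 2 * ennreal ((g x - G n x)\<^sup>2) \<partial>N)"
      proof (rule nn_integral_mono)
        fix x
        have "0 \<le> ((f x - F n x) - (g x - G n x))\<^sup>2" by simp
        then have "(f x + g x - (F n x + G n x))\<^sup>2 \<le> 2 * (f x - F n x)\<^sup>2 + 2 * (g x - G n x)\<^sup>2"
          by (simp add: power2_eq_square algebra_simps)
        then have "ennreal ((f x + g x - (F n x + G n x))\<^sup>2)
            \<le> ennreal (2 * (f x - F n x)\<^sup>2 + 2 * (g x - G n x)\<^sup>2)" by (rule ennreal_leI)
        then show "ennreal ((f x + g x - (F n x + G n x))\<^sup>2)
            \<le> 2 * ennreal ((f x - F n x)\<^sup>2) + 2 * ennreal ((g x - G n x)\<^sup>2)"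
          by (simp add: ennreal_mult)
      qed
      also have "\<dots> = 2 * (\<integral>\<^sup>+x. ennreal ((f x - F n x)\<^sup>2) \<partial>N) + 2 * (\<integral>\<^sup>+x. ennreal ((g x - G n x)\<^sup>2) \<partial>N)"
        by (simp add: nn_integral_add nn_integral_cmult)
      finally show "(\<integral>\<^sup>+x. ennreal ((f x + g x - (F n x + G n x))\<^sup>2) \<partial>N)
        \<le> 2 * (\<integral>\<^sup>+x. ennreal ((f x - F n x)\<^sup>2) \<partial>N) + 2 * (\<integral>\<^sup>+x. ennreal ((g x - G n x)\<^sup>2) \<partial>N)" .
    qed
  qed simp
qed

lemma L2_tendsto_cmult:
  fixes f :: "'a \<Rightarrow> real"
  assumes [measurable]: "f \<in> borel_measurable N" "\<And>n. F n \<in> borel_measurable N"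
    and f: "(\<lambda>n. \<integral>\<^sup>+x. ennreal ((f x - F n x)\<^sup>2) \<partial>N) \<longlonglongrightarrow> 0"
  shows "(\<lambda>n. \<integral>\<^sup>+x. ennreal ((k * f x - k * F n x)\<^sup>2) \<partial>N) \<longlonglongrightarrow> 0"
proof -
  have "(\<integral>\<^sup>+x. ennreal ((k * f x - k * F n x)\<^sup>2) \<partial>N) = ennreal (k\<^sup>2) * (\<integral>\<^sup>+x. ennreal ((f x - F n x)\<^sup>2) \<partial>N)" for n
    by (simp add: right_diff_distrib[symmetric] power_mult_distrib ennreal_mult nn_integral_cmult)
  then show ?thesis
    using ennreal_tendsto_cmult[OF _ f, of "ennreal (k\<^sup>2)"] by simp
qed

text \<open>Since \<open>\<bar>exp (i x) - exp (i y)\<bar> \<le> \<bar>x - y\<bar>\<close>, characteristic functions are controlled by the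
  distance in mean, hence by the one in mean square. The fixed summand \<open>U\<close> later carries the
  independent Gaussian process.\<close>

lemma (in prob_space) char_tendsto_L2:
  assumes [measurable]: "Y \<in> borel_measurable M" "\<And>n. Z n \<in> borel_measurable M"
    and Z: "\<And>n. integrable M (\<lambda>\<omega>. (Z n \<omega>)\<^sup>2)"
    and lim: "(\<lambda>n. \<integral>\<^sup>+\<omega>. ennreal ((Y \<omega> - Z n \<omega>)\<^sup>2) \<partial>M) \<longlonglongrightarrow> 0"
    and U[measurable]: "U \<in> borel_measurable M"
  shows "(\<lambda>n. char (distr M borel (\<lambda>\<omega>. U \<omega> + Z n \<omega>)) s) \<longlonglongrightarrow> char (distr M borel (\<lambda>\<omega>. U \<omega> + Y \<omega>)) s"
proof -
  note L = L2_limit[OF assms(1-4)]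
  have "(\<lambda>n. \<bar>s\<bar> * sqrt (\<integral>\<omega>. (Y \<omega> - Z n \<omega>)\<^sup>2 \<partial>M)) \<longlonglongrightarrow> \<bar>s\<bar> * sqrt 0"
    by (intro tendsto_intros L)
  then have bd: "(\<lambda>n. \<bar>s\<bar> * sqrt (\<integral>\<omega>. (Y \<omega> - Z n \<omega>)\<^sup>2 \<partial>M)) \<longlonglongrightarrow> 0" by simp
  have "(\<lambda>n. char (distr M borel (\<lambda>\<omega>. U \<omega> + Z n \<omega>)) s - char (distr M borel (\<lambda>\<omega>. U \<omega> + Y \<omega>)) s) \<longlonglongrightarrow> 0"
  proof (rule Lim_null_comparison[OF _ bd], rule always_eventually, rule allI)
    fix n
    have ab: "integrable M (\<lambda>\<omega>. \<bar>Y \<omega> - Z n \<omega>\<bar>)"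
      using integral_mult_le_sqrt(1)[of "\<lambda>\<omega>. Y \<omega> - Z n \<omega>" M "\<lambda>_. 1"] L(3)[of n] by auto
    have "norm (char (distr M borel (\<lambda>\<omega>. U \<omega> + Z n \<omega>)) s - char (distr M borel (\<lambda>\<omega>. U \<omega> + Y \<omega>)) s)
        = norm (CLINT \<omega>|M. iexp (s * (U \<omega> + Z n \<omega>)) - iexp (s * (U \<omega> + Y \<omega>)))"
      by (subst Bochner_Integration.integral_diff) (auto intro!: integrable_iexp simp: char_distr)
    also have "\<dots> \<le> (\<integral>\<omega>. norm (iexp (s * (U \<omega> + Z n \<omega>)) - iexp (s * (U \<omega> + Y \<omega>))) \<partial>M)"
      by (rule integral_norm_bound)
    also have "\<dots> \<le> (\<integral>\<omega>. \<bar>s\<bar> * \<bar>Y \<omega> - Z n \<omega>\<bar> \<partial>M)"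
    proof (rule integral_mono)
      show "integrable M (\<lambda>\<omega>. norm (iexp (s * (U \<omega> + Z n \<omega>)) - iexp (s * (U \<omega> + Y \<omega>))))"
        by (intro integrable_norm Bochner_Integration.integrable_diff integrable_iexp) auto
      fix \<omega>
      have "iexp (s * (U \<omega> + Z n \<omega>)) - iexp (s * (U \<omega> + Y \<omega>))
          = iexp (s * (U \<omega> + Y \<omega>)) * (iexp (s * (Z n \<omega> - Y \<omega>)) - 1)"
        by (simp add: right_diff_distrib exp_add[symmetric] algebra_simps)
      then have "norm (iexp (s * (U \<omega> + Z n \<omega>)) - iexp (s * (U \<omega> + Y \<omega>)))
          = norm (iexp (s * (Z n \<omega> - Y \<omega>)) - 1)" by (simp add: norm_mult)
      also have "\<dots> \<le> \<bar>s * (Z n \<omega> - Y \<omega>)\<bar>"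
        using iexp_approx1[of "s * (Z n \<omega> - Y \<omega>)" 0] by simp
      finally show "norm (iexp (s * (U \<omega> + Z n \<omega>)) - iexp (s * (U \<omega> + Y \<omega>))) \<le> \<bar>s\<bar> * \<bar>Y \<omega> - Z n \<omega>\<bar>"
        by (simp add: abs_mult abs_minus_commute)
    qed (use ab in simp)
    also have "\<dots> \<le> \<bar>s\<bar> * sqrt (\<integral>\<omega>. (Y \<omega> - Z n \<omega>)\<^sup>2 \<partial>M)"
      using integral_mult_le_sqrt(2)[of "\<lambda>\<omega>. Y \<omega> - Z n \<omega>" M "\<lambda>_. 1"] L(3)[of n]
      by (simp add: mult_left_mono prob_space)
    finally show "norm (char (distr M borel (\<lambda>\<omega>. U \<omega> + Z n \<omega>)) s - char (distr M borel (\<lambda>\<omega>. U \<omega> + Y \<omega>)) s)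
      \<le> \<bar>s\<bar> * sqrt (\<integral>\<omega>. (Y \<omega> - Z n \<omega>)\<^sup>2 \<partial>M)" .
  qed
  then show ?thesis by (simp add: Lim_null[symmetric])
qed

text \<open>Completeness of \<open>L\<^sup>2\<close>, for sequences that are Cauchy at a geometric rate. The rate makes the
  increments summable almost surely, so that the sequence converges almost surely; Fatou's lemma
  transfers the Cauchy bound to the limit.\<close>

lemma (in prob_space) L2_complete_geometric:
  fixes Z :: "nat \<Rightarrow> 'a \<Rightarrow> real"
  assumes Z[measurable]: "\<And>n. Z n \<in> borel_measurable M"
    and C: "0 \<le> C" and cauchy: "\<And>n m. n \<le> m \<Longrightarrow> (\<integral>\<^sup>+\<omega>. ennreal ((Z m \<omega> - Z n \<omega>)\<^sup>2) \<partial>M) \<le> ennreal (C * (1 / 4) ^ n)"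
  obtains Y where "Y \<in> borel_measurable M" "(\<lambda>n. \<integral>\<^sup>+\<omega>. ennreal ((Y \<omega> - Z n \<omega>)\<^sup>2) \<partial>M) \<longlonglongrightarrow> 0"
proof -
  have L1: "(\<integral>\<^sup>+\<omega>. ennreal \<bar>Z (Suc n) \<omega> - Z n \<omega>\<bar> \<partial>M) \<le> ennreal ((1 + C) * (1 / 2) ^ n)" for n
  proof -
    have "(\<integral>\<^sup>+\<omega>. ennreal \<bar>Z (Suc n) \<omega> - Z n \<omega>\<bar> \<partial>M)
        \<le> (\<integral>\<^sup>+\<omega>. ennreal ((1 / 2) ^ n) + ennreal (2 ^ n) * ennreal ((Z (Suc n) \<omega> - Z n \<omega>)\<^sup>2) \<partial>M)"
    proof (rule nn_integral_mono)
      fix \<omega>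
      define d where "d = \<bar>Z (Suc n) \<omega> - Z n \<omega>\<bar>"
      \<comment> \<open>Weighted arithmetic-geometric mean inequality: the weight \<open>2 ^ n\<close> balances the bound \<open>C / 4 ^ n\<close>.\<close>
      have "0 \<le> (1 - 2 ^ n * d)\<^sup>2 + 2 ^ n * d" by (simp add: d_def)
      then have "2 ^ n * d \<le> 1 + 2 ^ n * (2 ^ n * d\<^sup>2)"
        by (simp add: power2_eq_square algebra_simps)
      then have "d \<le> (1 / 2) ^ n + 2 ^ n * d\<^sup>2"
        by (simp add: power_one_over field_simps)
      then have "d \<le> (1 / 2) ^ n + 2 ^ n * (Z (Suc n) \<omega> - Z n \<omega>)\<^sup>2" by (simp add: d_def)
      then show "ennreal \<bar>Z (Suc n) \<omega> - Z n \<omega>\<bar>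
          \<le> ennreal ((1 / 2) ^ n) + ennreal (2 ^ n) * ennreal ((Z (Suc n) \<omega> - Z n \<omega>)\<^sup>2)"
        unfolding d_def[symmetric] by (simp add: ennreal_leI flip: ennreal_mult ennreal_plus)
    qed
    also have "\<dots> = ennreal ((1 / 2) ^ n)
        + ennreal (2 ^ n) * (\<integral>\<^sup>+\<omega>. ennreal ((Z (Suc n) \<omega> - Z n \<omega>)\<^sup>2) \<partial>M)"
      by (subst nn_integral_add) (auto simp: nn_integral_cmult emeasure_space_1)
    also have "\<dots> \<le> ennreal ((1 / 2) ^ n) + ennreal (2 ^ n) * ennreal (C * (1 / 4) ^ n)"
      by (intro add_left_mono mult_left_mono cauchy) auto
    also have "\<dots> = ennreal ((1 / 2) ^ n + 2 ^ n * (C * (1 / 4) ^ n))"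
      using C by (simp flip: ennreal_mult ennreal_plus)
    also have "2 ^ n * (C * (1 / 4) ^ n) = C * (1 / 2) ^ n"
      using power_mult_distrib[of "2 :: real" "1 / 4" n] by simp
    finally show ?thesis by (simp add: distrib_right)
  qed
  have "(\<integral>\<^sup>+\<omega>. (\<Sum>n. ennreal \<bar>Z (Suc n) \<omega> - Z n \<omega>\<bar>) \<partial>M) = (\<Sum>n. \<integral>\<^sup>+\<omega>. ennreal \<bar>Z (Suc n) \<omega> - Z n \<omega>\<bar> \<partial>M)"
    by (rule nn_integral_suminf) simp
  also have "\<dots> \<le> (\<Sum>n. ennreal ((1 + C) * (1 / 2) ^ n))"
    by (intro suminf_le L1) auto
  also have "\<dots> < \<infinity>"
    using C by (subst suminf_ennreal2) (auto intro!: summable_mult summable_geometric)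
  finally have "AE \<omega> in M. (\<Sum>n. ennreal \<bar>Z (Suc n) \<omega> - Z n \<omega>\<bar>) \<noteq> \<infinity>"
    by (intro nn_integral_PInf_AE) auto
  then have conv: "AE \<omega> in M. convergent (\<lambda>n. Z n \<omega>)"
  proof eventually_elim
    case (elim \<omega>)
    then have "summable (\<lambda>n. \<bar>Z (Suc n) \<omega> - Z n \<omega>\<bar>)"
      by (intro summable_suminf_not_top) auto
    then have "summable (\<lambda>n. Z (Suc n) \<omega> - Z n \<omega>)"
      by (rule summable_rabs_cancel)
    then have "convergent (\<lambda>n. Z n \<omega> - Z 0 \<omega>)"
      using sum_lessThan_telescope[of "\<lambda>i. Z i \<omega>"] by (simp add: summable_iff_convergent)
    then have "convergent (\<lambda>n. Z n \<omega> - Z 0 \<omega> + Z 0 \<omega>)"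
      by (intro convergent_add convergent_const)
    then show ?case by simp
  qed
  define Y where "Y \<omega> = lim (\<lambda>n. Z n \<omega>)" for \<omega>
  have Y[measurable]: "Y \<in> borel_measurable M" unfolding Y_def by (rule borel_measurable_lim_metric) simp
  have bound: "(\<integral>\<^sup>+\<omega>. ennreal ((Y \<omega> - Z n \<omega>)\<^sup>2) \<partial>M) \<le> ennreal (C * (1 / 4) ^ n)" for n
  proof -
    have "(\<integral>\<^sup>+\<omega>. ennreal ((Y \<omega> - Z n \<omega>)\<^sup>2) \<partial>M) = (\<integral>\<^sup>+\<omega>. liminf (\<lambda>m. ennreal ((Z m \<omega> - Z n \<omega>)\<^sup>2)) \<partial>M)"
    proof (rule nn_integral_cong_AE)
      show "AE \<omega> in M. ennreal ((Y \<omega> - Z n \<omega>)\<^sup>2) = liminf (\<lambda>m. ennreal ((Z m \<omega> - Z n \<omega>)\<^sup>2))"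
        using conv
      proof eventually_elim
        case (elim \<omega>)
        then have "(\<lambda>m. Z m \<omega>) \<longlonglongrightarrow> Y \<omega>" by (simp add: Y_def convergent_LIMSEQ_iff)
        then have "(\<lambda>m. ennreal ((Z m \<omega> - Z n \<omega>)\<^sup>2)) \<longlonglongrightarrow> ennreal ((Y \<omega> - Z n \<omega>)\<^sup>2)"
          by (intro tendsto_intros)
        then show ?case by (intro lim_imp_Liminf[symmetric]) auto
      qed
    qed
    also have "\<dots> \<le> liminf (\<lambda>m. \<integral>\<^sup>+\<omega>. ennreal ((Z m \<omega> - Z n \<omega>)\<^sup>2) \<partial>M)"
      by (rule nn_integral_liminf) simp
    also have "\<dots> \<le> liminf (\<lambda>m. ennreal (C * (1 / 4) ^ n))"
      by (intro Liminf_mono eventually_sequentiallyI[of n] cauchy)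
    also have "\<dots> = ennreal (C * (1 / 4) ^ n)" by (simp add: Liminf_const)
    finally show ?thesis .
  qed
  have "(\<lambda>n. ennreal (C * (1 / 4) ^ n)) \<longlonglongrightarrow> ennreal (C * 0)"
    by (intro tendsto_ennrealI tendsto_mult tendsto_const LIMSEQ_realpow_zero) auto
  then have "(\<lambda>n. ennreal (C * (1 / 4) ^ n)) \<longlonglongrightarrow> 0" by simp
  then have "(\<lambda>n. \<integral>\<^sup>+\<omega>. ennreal ((Y \<omega> - Z n \<omega>)\<^sup>2) \<partial>M) \<longlonglongrightarrow> 0"
    by (rule tendsto_sandwich[rotated 3, OF _ ]) (auto simp: bound)
  with Y show ?thesis by (rule that)
qed

context prob_space
begin

text \<open>The explicit form of the characteristic function passes to the limit, because the second
  moments converge as well.\<close>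

lemma centered_normal_add_limit:
  assumes [measurable]: "U \<in> borel_measurable M" "Y \<in> borel_measurable M" "\<And>n. Z n \<in> borel_measurable M"
    and Z: "\<And>n. integrable M (\<lambda>\<omega>. (Z n \<omega>)\<^sup>2)"
    and lim: "(\<lambda>n. \<integral>\<^sup>+\<omega>. ennreal ((Y \<omega> - Z n \<omega>)\<^sup>2) \<partial>M) \<longlonglongrightarrow> 0"
    and N: "\<And>n. centered_normal M (\<lambda>\<omega>. U \<omega> + Z n \<omega>) (v + expectation (\<lambda>\<omega>. (Z n \<omega>)\<^sup>2))"
    and v: "0 \<le> v"
  shows "centered_normal M (\<lambda>\<omega>. U \<omega> + Y \<omega>) (v + expectation (\<lambda>\<omega>. (Y \<omega>)\<^sup>2))"
proof -
  have "char (distr M borel (\<lambda>\<omega>. U \<omega> + Y \<omega>)) s = of_real (exp (- ((v + expectation (\<lambda>\<omega>. (Y \<omega>)\<^sup>2)) * s\<^sup>2 / 2)))" for s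
  proof (rule LIMSEQ_unique)
    show "(\<lambda>n. char (distr M borel (\<lambda>\<omega>. U \<omega> + Z n \<omega>)) s) \<longlonglongrightarrow> char (distr M borel (\<lambda>\<omega>. U \<omega> + Y \<omega>)) s"
      by (rule char_tendsto_L2[OF _ _ Z lim]) auto
    have "(\<lambda>n. complex_of_real (exp (- ((v + expectation (\<lambda>\<omega>. (Z n \<omega>)\<^sup>2)) * s\<^sup>2 / 2)))) \<longlonglongrightarrow>
        complex_of_real (exp (- ((v + expectation (\<lambda>\<omega>. (Y \<omega>)\<^sup>2)) * s\<^sup>2 / 2)))"
      by (intro tendsto_intros L2_limit(2)[OF _ _ Z lim]) auto
    then show "(\<lambda>n. char (distr M borel (\<lambda>\<omega>. U \<omega> + Z n \<omega>)) s) \<longlonglongrightarrow>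
        of_real (exp (- ((v + expectation (\<lambda>\<omega>. (Y \<omega>)\<^sup>2)) * s\<^sup>2 / 2)))"
      using N by (simp add: centered_normal_def)
  qed
  then show ?thesis using v by (simp add: centered_normal_def)
qed

lemma centered_normal_add_indep:
  assumes "indep_var borel X borel Y" "centered_normal M X v" "centered_normal M Y w"
  shows "centered_normal M (\<lambda>\<omega>. X \<omega> + Y \<omega>) (v + w)"
proof -
  have "char (distr M borel (\<lambda>\<omega>. X \<omega> + Y \<omega>)) s = of_real (exp (- ((v + w) * s\<^sup>2 / 2)))" for s
    using assms(2,3) by (simp add: char_distr_add[OF assms(1)] centered_normal_def exp_add[symmetric]
      of_real_mult[symmetric] add_divide_distrib distrib_right del: of_real_mult)
  then show ?thesis using assms(2,3) by (auto simp: centered_normal_def)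
qed

end

section \<open>Step functions and their integrals\<close>

text \<open>The side condition that the Wiener integral puts on its approximating step functions.\<close>

definition step_list :: "(real \<times> real \<times> real) list \<Rightarrow> bool" where
  "step_list P \<longleftrightarrow> (\<forall>(u, v, c)\<in>set P. 0 \<le> u \<and> u \<le> v)"

lemma step_list_simps [simp]:
  "step_list []"
  "step_list ((u, v, c) # P) \<longleftrightarrow> 0 \<le> u \<and> u \<le> v \<and> step_list P"
  "step_list (P @ Q) \<longleftrightarrow> step_list P \<and> step_list Q"
  by (simp_all add: step_list_def ball_Un)

lemma step_fun_simps [simp]:
  "step_fun [] r = 0"
  "step_fun ((u, v, c) # P) r = c * indicator {u<..v} r + step_fun P r"
  "step_fun (P @ Q) r = step_fun P r + step_fun Q r"
  by (auto simp: step_fun_def)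

lemma step_integral_simps [simp]:
  "step_integral W [] \<omega> = 0"
  "step_integral W ((u, v, c) # P) \<omega> = c * (W v \<omega> - W u \<omega>) + step_integral W P \<omega>"
  "step_integral W (P @ Q) \<omega> = step_integral W P \<omega> + step_integral W Q \<omega>"
  by (auto simp: step_integral_def)

definition scale_steps :: "real \<Rightarrow> (real \<times> real \<times> real) list \<Rightarrow> (real \<times> real \<times> real) list" where
  "scale_steps k P = map (\<lambda>(u, v, c). (u, v, k * c)) P"

lemma scale_steps [simp]:
  "step_fun (scale_steps k P) r = k * step_fun P r"
  "step_integral W (scale_steps k P) \<omega> = k * step_integral W P \<omega>"
  "step_list (scale_steps k P) \<longleftrightarrow> step_list P"
  by (induction P) (auto simp: scale_steps_def algebra_simps)

text \<open>The indicator of \<open>(u, v]\<close> is an increment of the indicator of \<open>(-\<infinity>, t]\<close> in \<open>t\<close>, so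
  a step function is itself a step integral, of a deterministic process. Any rewriting of increments
  therefore applies to step functions and to their stochastic integrals alike.\<close>

lemma step_fun_eq_step_integral:
  "step_list P \<Longrightarrow> step_fun P r = step_integral (\<lambda>t r. indicator {..t} r) P r"
  by (induction P) (auto split: split_indicator)

lemma step_fun_measurable [measurable]: "step_fun P \<in> borel_measurable borel"
proof (induction P)
  case (Cons p P)
  obtain u v c where p: "p = (u, v, c)" by (cases p)
  have "step_fun (p # P) = (\<lambda>r. c * indicator {u<..v} r + step_fun P r)"
    by (rule ext) (simp add: p)
  with Cons show ?case by simp
qed (simp add: step_fun_def)

lemma step_integral_measurable:
  assumes "\<And>t. 0 \<le> t \<Longrightarrow> W t \<in> borel_measurable M" and "step_list P"
  shows "step_integral W P \<in> borel_measurable M"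
  using assms(2)
proof (induction P)
  case (Cons p P)
  obtain u v c where p: "p = (u, v, c)" by (cases p)
  have "step_integral W (p # P) = (\<lambda>r. c * (W v r - W u r) + step_integral W P r)"
    by (rule ext) (simp add: p)
  with Cons p show ?case by (auto intro!: borel_measurable_add borel_measurable_times borel_measurable_diff assms)
qed (simp add: step_integral_def[abs_def])

lemma sorted_enumeration:
  fixes E :: "real set"
  assumes "finite E" "E \<noteq> {}"
  obtains n and \<tau> :: "nat \<Rightarrow> real" where "E = \<tau> ` {..n}" "\<And>i. i < n \<Longrightarrow> \<tau> i < \<tau> (Suc i)"
proof -
  define l where "l = sorted_list_of_set E"
  have l: "set l = E" "sorted_wrt (<) l" "l \<noteq> []"
    using assms by (auto simp: l_def)
  show ?thesis
  proof (rule that[where n = "length l - 1" and \<tau> = "\<lambda>i. l ! i"])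
    have "{..length l - 1} = {..<length l}" using l(3) by (cases l) auto
    then show "E = (\<lambda>i. l ! i) ` {..length l - 1}" using l(1)
      by (auto simp: set_conv_nth)
    show "l ! i < l ! Suc i" if "i < length l - 1" for i
      using sorted_wrt_nth_less[OF l(2), of i "Suc i"] that by simp
  qed
qed

lemma strict_chain:
  fixes \<tau> :: "nat \<Rightarrow> real"
  assumes "\<And>i. i < n \<Longrightarrow> \<tau> i < \<tau> (Suc i)" and "i < j" "j \<le> n"
  shows "\<tau> i < \<tau> j"
  using assms(2,3)
proof (induction j)
  case (Suc j)
  have "\<tau> i \<le> \<tau> j"
    using Suc by (cases "i = j") auto
  with assms(1)[of j] Suc.prems show ?case by simp
qed simp

text \<open>The intervals of \<open>P\<close> may overlap; cutting at all their end points rewrites every combination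
  of increments over \<open>P\<close> as one over the successive intervals of a partition, with coefficients that
  depend only on \<open>P\<close>. The function \<open>G\<close> is arbitrary so that the same \<open>\<tau>\<close> and \<open>d\<close> serve for
  the Brownian path and for the indicator of a half line.\<close>

lemma common_partition:
  assumes P: "step_list P"
  obtains n \<tau> d where "0 \<le> \<tau> 0" "\<And>i. i < n \<Longrightarrow> \<tau> i < \<tau> (Suc i)"
    "\<And>G :: real \<Rightarrow> real. (\<Sum>(u, v, c)\<leftarrow>P. c * (G v - G u)) = (\<Sum>i<n. d i * (G (\<tau> (Suc i)) - G (\<tau> i)))"
proof -
  define E where "E = insert 0 (fst ` set P \<union> (fst \<circ> snd) ` set P)"
  have "finite E" "E \<noteq> {}" by (auto simp: E_def)
  then obtain n \<tau> where E: "E = \<tau> ` {..n}" and \<tau>: "\<And>i. i < n \<Longrightarrow> \<tau> i < \<tau> (Suc i)"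
    using sorted_enumeration by blast
  note less = strict_chain[of n \<tau>, OF \<tau>]
  have le_iff: "\<tau> i \<le> \<tau> j \<longleftrightarrow> i \<le> j" if "i \<le> n" "j \<le> n" for i j
    using less[of i j] less[of j i] that by (cases i j rule: linorder_cases) auto
  have "\<tau> 0 \<in> E" using E by auto
  moreover have "\<forall>t\<in>E. 0 \<le> t" using P by (fastforce simp: E_def step_list_def)
  ultimately have 0: "0 \<le> \<tau> 0" by blast
  \<comment> \<open>\<open>w u v i\<close> tells whether the \<open>i\<close>-th interval of the partition lies in \<open>(u, v]\<close>.\<close>
  define w where "w u v i = (if u \<le> \<tau> i \<and> \<tau> (Suc i) \<le> v then 1 else 0 :: real)" for u v i
  have telescope: "G v - G u = (\<Sum>i<n. w u v i * (G (\<tau> (Suc i)) - G (\<tau> i)))"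
    if uv: "u \<in> E" "v \<in> E" "u \<le> v" for u v and G :: "real \<Rightarrow> real"
  proof -
    obtain j k where jk: "u = \<tau> j" "v = \<tau> k" "j \<le> n" "k \<le> n" using uv E by auto
    with uv have "j \<le> k" using le_iff by simp
    have "(\<Sum>i<n. w u v i * (G (\<tau> (Suc i)) - G (\<tau> i))) = (\<Sum>i\<in>{j..<k}. G (\<tau> (Suc i)) - G (\<tau> i))"
      by (rule sum.mono_neutral_cong_right) (use jk in \<open>auto simp: w_def le_iff\<close>)
    also have "\<dots> = G v - G u" using sum_Suc_diff'[OF \<open>j \<le> k\<close>, of "\<lambda>i. G (\<tau> i)"] jk by simp
    finally show ?thesis by simp
  qed
  define d where "d i = (\<Sum>(u, v, c)\<leftarrow>P. c * w u v i)" for i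
  have "(\<Sum>(u, v, c)\<leftarrow>Q. c * (G v - G u)) = (\<Sum>i<n. (\<Sum>(u, v, c)\<leftarrow>Q. c * w u v i) * (G (\<tau> (Suc i)) - G (\<tau> i)))"
    if "set Q \<subseteq> set P" for Q and G :: "real \<Rightarrow> real"
    using that
  proof (induction Q)
    case (Cons p Q)
    obtain u v c where p: "p = (u, v, c)" by (cases p)
    have "(u, v, c) \<in> set P" using Cons.prems p by simp
    then have "u \<in> E" "v \<in> E" "u \<le> v"
      using P image_eqI[of u fst "(u, v, c)"] image_eqI[of v "fst \<circ> snd" "(u, v, c)"]
      by (auto simp: E_def step_list_def)
    from telescope[OF this, of G] show ?case
      using Cons p by (simp add: sum_distrib_left sum.distrib distrib_right mult.assoc)
  qed simp
  from this[of P] show ?thesis by (intro that[OF 0 \<tau>, where d = d]) (auto simp: d_def)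
qed

text \<open>The intervals are disjoint, so the cross terms vanish.\<close>

lemma integral_step_fun_square_partition:
  fixes \<tau> :: "nat \<Rightarrow> real"
  assumes \<tau>: "\<And>i. i < n \<Longrightarrow> \<tau> i < \<tau> (Suc i)"
  shows "integrable lborel (\<lambda>r. (\<Sum>i<n. d i * (indicator {..\<tau> (Suc i)} r - indicator {..\<tau> i} r :: real))\<^sup>2)"
    and "(\<integral>r. (\<Sum>i<n. d i * (indicator {..\<tau> (Suc i)} r - indicator {..\<tau> i} r))\<^sup>2 \<partial>lborel)
      = (\<Sum>i<n. (d i)\<^sup>2 * (\<tau> (Suc i) - \<tau> i))"
proof -
  note less = strict_chain[of n \<tau>, OF \<tau>]
  have le: "\<tau> i \<le> \<tau> j" if "i \<le> j" "j \<le> n" for i j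
    using less[of i j] that by (cases "i = j") auto
  have *: "(\<Sum>i<n. d i * (indicator {..\<tau> (Suc i)} r - indicator {..\<tau> i} r :: real))\<^sup>2
      = (\<Sum>i<n. (d i)\<^sup>2 * indicator {\<tau> i<..\<tau> (Suc i)} r)" for r
  proof -
    have ind: "indicator {..\<tau> (Suc i)} r - indicator {..\<tau> i} r = (indicator {\<tau> i<..\<tau> (Suc i)} r :: real)"
      if "i < n" for i
      using \<tau>[OF that] by (auto split: split_indicator)
    have disj: "indicator {\<tau> i<..\<tau> (Suc i)} r * indicator {\<tau> j<..\<tau> (Suc j)} r = (0::real)"
      if "i < n" "j < n" "i \<noteq> j" for i j
      using that le[of "Suc i" j] le[of "Suc j" i]
      by (cases i j rule: linorder_cases) (auto split: split_indicator)
    have "(\<Sum>i<n. d i * (indicator {..\<tau> (Suc i)} r - indicator {..\<tau> i} r :: real))\<^sup>2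
        = (\<Sum>i<n. d i * indicator {\<tau> i<..\<tau> (Suc i)} r)\<^sup>2"
      by (simp add: ind)
    also have "\<dots> = (\<Sum>i<n. \<Sum>j<n. (d i * indicator {\<tau> i<..\<tau> (Suc i)} r) * (d j * indicator {\<tau> j<..\<tau> (Suc j)} r))"
      unfolding power2_eq_square by (rule sum_product)
    also have "\<dots> = (\<Sum>i<n. \<Sum>j<n. if j = i then (d i)\<^sup>2 * indicator {\<tau> i<..\<tau> (Suc i)} r else 0)"
    proof (intro sum.cong refl)
      fix i j assume "i \<in> {..<n}" "j \<in> {..<n}"
      then show "(d i * indicator {\<tau> i<..\<tau> (Suc i)} r) * (d j * indicator {\<tau> j<..\<tau> (Suc j)} r)
          = (if j = i then (d i)\<^sup>2 * indicator {\<tau> i<..\<tau> (Suc i)} r else 0)"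
        using disj[of i j] by (auto simp: power2_eq_square split: split_indicator)
    qed
    also have "\<dots> = (\<Sum>i<n. (d i)\<^sup>2 * indicator {\<tau> i<..\<tau> (Suc i)} r)" by simp
    finally show ?thesis .
  qed
  have int: "integrable lborel (\<lambda>r. (d i)\<^sup>2 * (indicator {\<tau> i<..\<tau> (Suc i)} r :: real))" if "i < n" for i
    using \<tau>[OF that] by (intro integrable_mult_right integrable_real_indicator) auto
  show "integrable lborel (\<lambda>r. (\<Sum>i<n. d i * (indicator {..\<tau> (Suc i)} r - indicator {..\<tau> i} r :: real))\<^sup>2)"
    unfolding * using int by (intro Bochner_Integration.integrable_sum) auto
  have "(\<integral>r. (\<Sum>i<n. d i * (indicator {..\<tau> (Suc i)} r - indicator {..\<tau> i} r))\<^sup>2 \<partial>lborel)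
      = (\<Sum>i<n. \<integral>r. (d i)\<^sup>2 * (indicator {\<tau> i<..\<tau> (Suc i)} r) \<partial>lborel)"
    unfolding * using int by (intro Bochner_Integration.integral_sum) auto
  also have "\<dots> = (\<Sum>i<n. (d i)\<^sup>2 * (\<tau> (Suc i) - \<tau> i))"
    using \<tau> by (intro sum.cong refl) (simp add: less_imp_le)
  finally show "(\<integral>r. (\<Sum>i<n. d i * (indicator {..\<tau> (Suc i)} r - indicator {..\<tau> i} r))\<^sup>2 \<partial>lborel)
      = (\<Sum>i<n. (d i)\<^sup>2 * (\<tau> (Suc i) - \<tau> i))" .
qed

text \<open>The characteristic function of a sum of independent variables is the product of theirs.\<close>

lemma (in prob_space) centered_normal_indep_increments:
  fixes \<tau> :: "nat \<Rightarrow> real"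
  assumes W: "standard_brownian_motion M W"
    and "0 \<le> \<tau> 0" and \<tau>: "\<And>i. i < n \<Longrightarrow> \<tau> i < \<tau> (Suc i)"
  shows "centered_normal M (\<lambda>\<omega>. \<Sum>i<n. d i * (W (\<tau> (Suc i)) \<omega> - W (\<tau> i) \<omega>))
     (\<Sum>i<n. (d i)\<^sup>2 * (\<tau> (Suc i) - \<tau> i))"
proof -
  let ?D = "\<lambda>i \<omega>. W (\<tau> (Suc i)) \<omega> - W (\<tau> i) \<omega>"
  have pos: "0 \<le> \<tau> i" if "i \<le> n" for i
    using assms(2) strict_chain[of n \<tau>, OF \<tau>, of 0 i] that by (cases "i = 0") auto
  have N: "centered_normal M (?D i) (\<tau> (Suc i) - \<tau> i)" if "i < n" for i
    using centered_normal_distributed(1)[of "sqrt (\<tau> (Suc i) - \<tau> i)" "?D i"] \<tau>[OF that] pos[of i] that W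
    by (simp add: standard_brownian_motion_def)
  then have Dm: "?D i \<in> borel_measurable M" if "i < n" for i
    using that by (simp add: centered_normal_def)
  have "indep_vars (\<lambda>_. borel) ?D {..<n}"
    using W assms(2) \<tau> unfolding standard_brownian_motion_def by blast
  then have ind: "indep_vars (\<lambda>_. borel) (\<lambda>i \<omega>. d i * ?D i \<omega>) {..<n}"
    by (rule indep_vars_compose2[where Y = "\<lambda>i x. d i * x"]) simp
  have "char (distr M borel (\<lambda>\<omega>. \<Sum>i<n. d i * ?D i \<omega>)) s
      = exp (- ((\<Sum>i<n. (d i)\<^sup>2 * (\<tau> (Suc i) - \<tau> i)) * s\<^sup>2 / 2))" for s
  proof -
    have "char (distr M borel (\<lambda>\<omega>. \<Sum>i<n. d i * ?D i \<omega>)) s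
        = (\<Prod>i<n. char (distr M borel (\<lambda>\<omega>. d i * ?D i \<omega>)) s)"
      by (rule char_distr_sum[OF ind])
    also have "\<dots> = (\<Prod>i<n. of_real (exp (- ((\<tau> (Suc i) - \<tau> i) * (s * d i)\<^sup>2 / 2))))"
      using N Dm by (intro prod.cong refl) (simp add: char_distr_cmult centered_normal_def)
    also have "\<dots> = of_real (exp (\<Sum>i<n. - ((\<tau> (Suc i) - \<tau> i) * (s * d i)\<^sup>2 / 2)))"
      by (simp add: exp_sum)
    also have "(\<Sum>i<n. - ((\<tau> (Suc i) - \<tau> i) * (s * d i)\<^sup>2 / 2))
        = - ((\<Sum>i<n. (d i)\<^sup>2 * (\<tau> (Suc i) - \<tau> i)) * s\<^sup>2 / 2)"
      by (simp add: sum_negf sum_divide_distrib[symmetric] sum_distrib_right sum_distrib_left power_mult_distrib mult_ac)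
    finally show ?thesis .
  qed
  moreover have "0 \<le> (\<Sum>i<n. (d i)\<^sup>2 * (\<tau> (Suc i) - \<tau> i))"
    using \<tau> by (intro sum_nonneg) (auto simp: less_imp_le)
  moreover have "(\<lambda>\<omega>. \<Sum>i<n. d i * ?D i \<omega>) \<in> borel_measurable M"
    using Dm by (intro borel_measurable_sum) auto
  ultimately show ?thesis by (simp add: centered_normal_def)
qed

lemma integrable_step_fun_square:
  assumes "step_list P" shows "integrable lborel (\<lambda>r. (step_fun P r)\<^sup>2)"
proof -
  obtain n \<tau> d where \<tau>: "\<And>i. i < n \<Longrightarrow> \<tau> i < \<tau> (Suc i)"
    and G: "\<And>G :: real \<Rightarrow> real. (\<Sum>(u, v, c)\<leftarrow>P. c * (G v - G u)) = (\<Sum>i<n. d i * (G (\<tau> (Suc i)) - G (\<tau> i)))"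
    by (rule common_partition[OF assms]) blast
  show ?thesis
    using integral_step_fun_square_partition(1)[where n = n and \<tau> = \<tau> and d = d, OF \<tau>]
    by (simp add: step_fun_eq_step_integral[OF assms] step_integral_def G)
qed

text \<open>The Wiener isometry for step functions: on a common partition the variance of the integral
  and the square integral of the step function are the same finite sum.\<close>

lemma (in prob_space) centered_normal_step_integral:
  assumes W: "standard_brownian_motion M W" and P: "step_list P"
  shows "centered_normal M (step_integral W P) (\<integral>r. (step_fun P r)\<^sup>2 \<partial>lborel)"
proof -
  obtain n \<tau> d where \<tau>: "0 \<le> \<tau> 0" "\<And>i. i < n \<Longrightarrow> \<tau> i < \<tau> (Suc i)"
    and G: "\<And>G :: real \<Rightarrow> real. (\<Sum>(u, v, c)\<leftarrow>P. c * (G v - G u)) = (\<Sum>i<n. d i * (G (\<tau> (Suc i)) - G (\<tau> i)))"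
    by (rule common_partition[OF P]) blast
  have "step_integral W P = (\<lambda>\<omega>. \<Sum>i<n. d i * (W (\<tau> (Suc i)) \<omega> - W (\<tau> i) \<omega>))"
    by (rule ext) (simp add: step_integral_def G)
  then show ?thesis
    using centered_normal_indep_increments[where n = n and \<tau> = \<tau> and d = d, OF W \<tau>] integral_step_fun_square_partition(2)[where n = n and \<tau> = \<tau> and d = d, OF \<tau>(2)]
    by (simp add: step_fun_eq_step_integral[OF P] step_integral_def G)
qed

lemma step_fun_nonpos: "step_list P \<Longrightarrow> r \<le> 0 \<Longrightarrow> step_fun P r = 0"
  by (induction P) (auto split: split_indicator)

section \<open>The Wiener integral as a Gaussian isometry\<close>

text \<open>Extending by zero to the whole line replaces integrals over \<open>{0..}\<close> by integrals with respect
  to \<open>lborel\<close>, as step functions with nonnegative end points vanish on the negative half line.\<close>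

definition half_line :: "(real \<Rightarrow> real) \<Rightarrow> real \<Rightarrow> real" where
  "half_line f r = indicator {0..} r * f r"

text \<open>Limits of step functions in \<open>L\<^sup>2\<close> are square integrable, so that a Wiener integral can be
  recognized from the two approximation properties.\<close>

lemma has_wiener_integral_iff:
  "has_wiener_integral M W f I \<longleftrightarrow>
     half_line f \<in> borel_measurable lborel \<and> I \<in> borel_measurable M \<and>
     (\<exists>P. (\<forall>n. step_list (P n)) \<and>
        (\<lambda>n. \<integral>\<^sup>+ r. ennreal ((half_line f r - step_fun (P n) r)\<^sup>2) \<partial>lborel) \<longlonglongrightarrow> 0 \<and>
        (\<lambda>n. \<integral>\<^sup>+ \<omega>. ennreal ((I \<omega> - step_integral W (P n) \<omega>)\<^sup>2) \<partial>M) \<longlonglongrightarrow> 0)"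
    (is "?L \<longleftrightarrow> ?R")
proof -
  have hl: "set_borel_measurable lborel {0..} f \<longleftrightarrow> half_line f \<in> borel_measurable lborel"
    by (simp add: set_borel_measurable_def half_line_def[abs_def])
  have sq: "set_integrable lborel {0..} (\<lambda>r. (f r)\<^sup>2) \<longleftrightarrow> integrable lborel (\<lambda>r. (half_line f r)\<^sup>2)"
    unfolding set_integrable_def half_line_def
    by (rule Bochner_Integration.integrable_cong) (auto split: split_indicator)
  have dist: "(\<integral>\<^sup>+ r\<in>{0..}. ennreal ((f r - step_fun Q r)\<^sup>2) \<partial>lborel)
      = (\<integral>\<^sup>+ r. ennreal ((half_line f r - step_fun Q r)\<^sup>2) \<partial>lborel)" if "step_list Q" for Q
    by (rule nn_integral_cong) (auto simp: half_line_def indicator_def step_fun_nonpos[OF that])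
  have approx: "(\<forall>n. \<forall>(u, v, c)\<in>set (P n). 0 \<le> u \<and> u \<le> v) \<and>
      (\<lambda>n. \<integral>\<^sup>+ r\<in>{0..}. ennreal ((f r - step_fun (P n) r)\<^sup>2) \<partial>lborel) \<longlonglongrightarrow> 0 \<and> R
    \<longleftrightarrow> (\<forall>n. step_list (P n)) \<and>
      (\<lambda>n. \<integral>\<^sup>+ r. ennreal ((half_line f r - step_fun (P n) r)\<^sup>2) \<partial>lborel) \<longlonglongrightarrow> 0 \<and> R" for P R
  proof (cases "\<forall>n. step_list (P n)")
    case True
    then have "(\<lambda>n. \<integral>\<^sup>+ r\<in>{0..}. ennreal ((f r - step_fun (P n) r)\<^sup>2) \<partial>lborel)
        = (\<lambda>n. \<integral>\<^sup>+ r. ennreal ((half_line f r - step_fun (P n) r)\<^sup>2) \<partial>lborel)"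
      using dist by blast
    then show ?thesis by (simp only: step_list_def)
  next
    case False
    then show ?thesis by (simp only: step_list_def simp_thms)
  qed
  have "?L \<longleftrightarrow> integrable lborel (\<lambda>r. (half_line f r)\<^sup>2) \<and> ?R"
    unfolding has_wiener_integral_def hl sq approx by (simp only: conj_ac)
  moreover have "integrable lborel (\<lambda>r. (half_line f r)\<^sup>2)" if R: ?R
  proof -
    obtain P where P: "\<And>n. step_list (P n)"
      "(\<lambda>n. \<integral>\<^sup>+ r. ennreal ((half_line f r - step_fun (P n) r)\<^sup>2) \<partial>lborel) \<longlonglongrightarrow> 0"
      using R by blast
    show ?thesis
      by (rule L2_limit(1)[OF _ _ _ P(2)]) (use R integrable_step_fun_square P(1) in auto)
  qed
  ultimately show ?thesis by blast
qed

lemma has_wiener_integral_add: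
  assumes W: "\<And>t. 0 \<le> t \<Longrightarrow> W t \<in> borel_measurable M"
    and f: "has_wiener_integral M W f I" and g: "has_wiener_integral M W g J"
  shows "has_wiener_integral M W (\<lambda>r. f r + g r) (\<lambda>\<omega>. I \<omega> + J \<omega>)"
proof -
  obtain P where P: "\<And>n. step_list (P n)"
    "(\<lambda>n. \<integral>\<^sup>+ r. ennreal ((half_line f r - step_fun (P n) r)\<^sup>2) \<partial>lborel) \<longlonglongrightarrow> 0"
    "(\<lambda>n. \<integral>\<^sup>+ \<omega>. ennreal ((I \<omega> - step_integral W (P n) \<omega>)\<^sup>2) \<partial>M) \<longlonglongrightarrow> 0"
    using f unfolding has_wiener_integral_iff by blast
  obtain Q where Q: "\<And>n. step_list (Q n)"
    "(\<lambda>n. \<integral>\<^sup>+ r. ennreal ((half_line g r - step_fun (Q n) r)\<^sup>2) \<partial>lborel) \<longlonglongrightarrow> 0"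
    "(\<lambda>n. \<integral>\<^sup>+ \<omega>. ennreal ((J \<omega> - step_integral W (Q n) \<omega>)\<^sup>2) \<partial>M) \<longlonglongrightarrow> 0"
    using g unfolding has_wiener_integral_iff by blast
  have m: "half_line f \<in> borel_measurable lborel" "half_line g \<in> borel_measurable lborel"
    "I \<in> borel_measurable M" "J \<in> borel_measurable M"
    using f g unfolding has_wiener_integral_iff by blast+
  have e: "half_line (\<lambda>r. f r + g r) = (\<lambda>r. half_line f r + half_line g r)"
    by (rule ext) (simp add: half_line_def distrib_left)
  show ?thesis
    unfolding has_wiener_integral_iff
  proof (intro conjI exI[of _ "\<lambda>n. P n @ Q n"])
    show "(\<lambda>n. \<integral>\<^sup>+ r. ennreal ((half_line (\<lambda>r. f r + g r) r - step_fun (P n @ Q n) r)\<^sup>2) \<partial>lborel) \<longlonglongrightarrow> 0"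
      using L2_tendsto_add[OF m(1,2) _ _ P(2) Q(2)] by (simp add: e)
    show "(\<lambda>n. \<integral>\<^sup>+ \<omega>. ennreal ((I \<omega> + J \<omega> - step_integral W (P n @ Q n) \<omega>)\<^sup>2) \<partial>M) \<longlonglongrightarrow> 0"
      using L2_tendsto_add[OF m(3,4) step_integral_measurable[OF W P(1)] step_integral_measurable[OF W Q(1)] P(3) Q(3)]
      by simp
  qed (use P(1) Q(1) m in \<open>auto simp: e\<close>)
qed

lemma has_wiener_integral_cmult:
  assumes W: "\<And>t. 0 \<le> t \<Longrightarrow> W t \<in> borel_measurable M"
    and f: "has_wiener_integral M W f I"
  shows "has_wiener_integral M W (\<lambda>r. k * f r) (\<lambda>\<omega>. k * I \<omega>)"
proof -
  obtain P where P: "\<And>n. step_list (P n)"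
    "(\<lambda>n. \<integral>\<^sup>+ r. ennreal ((half_line f r - step_fun (P n) r)\<^sup>2) \<partial>lborel) \<longlonglongrightarrow> 0"
    "(\<lambda>n. \<integral>\<^sup>+ \<omega>. ennreal ((I \<omega> - step_integral W (P n) \<omega>)\<^sup>2) \<partial>M) \<longlonglongrightarrow> 0"
    using f unfolding has_wiener_integral_iff by blast
  have m: "half_line f \<in> borel_measurable lborel" "I \<in> borel_measurable M"
    using f unfolding has_wiener_integral_iff by blast+
  have e: "half_line (\<lambda>r. k * f r) = (\<lambda>r. k * half_line f r)"
    by (rule ext) (simp add: half_line_def)
  show ?thesis
    unfolding has_wiener_integral_iff
  proof (intro conjI exI[of _ "\<lambda>n. scale_steps k (P n)"])
    show "(\<lambda>n. \<integral>\<^sup>+ r. ennreal ((half_line (\<lambda>r. k * f r) r - step_fun (scale_steps k (P n)) r)\<^sup>2) \<partial>lborel) \<longlonglongrightarrow> 0"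
      using L2_tendsto_cmult[OF m(1) _ P(2)] by (simp add: e)
    show "(\<lambda>n. \<integral>\<^sup>+ \<omega>. ennreal ((k * I \<omega> - step_integral W (scale_steps k (P n)) \<omega>)\<^sup>2) \<partial>M) \<longlonglongrightarrow> 0"
      using L2_tendsto_cmult[OF m(2) step_integral_measurable[OF W P(1)] P(3)] by simp
  qed (use P(1) m in \<open>auto simp: e\<close>)
qed

lemma has_wiener_integral_zero: "has_wiener_integral M W (\<lambda>_. 0) (\<lambda>_. 0)"
  unfolding has_wiener_integral_iff
  by (intro conjI exI[of _ "\<lambda>_. []"]) (auto simp: half_line_def[abs_def])

lemma has_wiener_integral_sum:
  assumes W: "\<And>t. 0 \<le> t \<Longrightarrow> W t \<in> borel_measurable M"
    and "finite F" and "\<And>t. t \<in> F \<Longrightarrow> has_wiener_integral M W (f t) (I t)"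
  shows "has_wiener_integral M W (\<lambda>r. \<Sum>t\<in>F. c t * f t r) (\<lambda>\<omega>. \<Sum>t\<in>F. c t * I t \<omega>)"
  using assms(2,3)
proof (induction F rule: finite_induct)
  case (insert t F)
  then show ?case
    using has_wiener_integral_add[OF W has_wiener_integral_cmult[OF W, where k = "c t" and f = "f t" and I = "I t"]]
    by simp
qed (simp add: has_wiener_integral_zero)

context prob_space
begin

text \<open>The law of a Wiener integral, alone and added to a variable that is independent of all step
  integrals. Independence is stated for the step integrals because they are explicit functions
  of finitely many values of \<open>W\<close>.\<close>

lemma wiener_integral_law:
  assumes W: "standard_brownian_motion M W" and I: "has_wiener_integral M W f I"
  shows "centered_normal M I (\<integral>r. (half_line f r)\<^sup>2 \<partial>lborel)"
    and "\<And>U v. centered_normal M U v \<Longrightarrow>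
      (\<And>P. step_list P \<Longrightarrow> indep_var borel U borel (step_integral W P)) \<Longrightarrow>
      centered_normal M (\<lambda>\<omega>. U \<omega> + I \<omega>) (v + (\<integral>r. (half_line f r)\<^sup>2 \<partial>lborel))"
proof -
  obtain P where P: "\<And>n. step_list (P n)"
    "(\<lambda>n. \<integral>\<^sup>+ r. ennreal ((half_line f r - step_fun (P n) r)\<^sup>2) \<partial>lborel) \<longlonglongrightarrow> 0"
    "(\<lambda>n. \<integral>\<^sup>+ \<omega>. ennreal ((I \<omega> - step_integral W (P n) \<omega>)\<^sup>2) \<partial>M) \<longlonglongrightarrow> 0"
    using I unfolding has_wiener_integral_iff by blast
  have m: "half_line f \<in> borel_measurable lborel" "I \<in> borel_measurable M"
    using I unfolding has_wiener_integral_iff by blast+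
  let ?Z = "\<lambda>n. step_integral W (P n)"
  note Z = centered_normal_step_integral[OF W P(1)]
  have Zm: "?Z n \<in> borel_measurable M" for n using Z[of n] by (simp add: centered_normal_def)
  have Zi: "integrable M (\<lambda>\<omega>. (?Z n \<omega>)\<^sup>2)" for n
    by (rule centered_normal_imp_gaussian_rv(3)[OF Z])
  have Ze: "expectation (\<lambda>\<omega>. (?Z n \<omega>)\<^sup>2) = (\<integral>r. (step_fun (P n) r)\<^sup>2 \<partial>lborel)" for n
    by (rule centered_normal_imp_gaussian_rv(4)[OF Z])
  have "(\<lambda>n. \<integral>r. (step_fun (P n) r)\<^sup>2 \<partial>lborel) \<longlonglongrightarrow> (\<integral>r. (half_line f r)\<^sup>2 \<partial>lborel)"
    by (rule L2_limit(2)[OF m(1) _ _ P(2)]) (auto intro: integrable_step_fun_square P(1))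
  moreover have "(\<lambda>n. expectation (\<lambda>\<omega>. (?Z n \<omega>)\<^sup>2)) \<longlonglongrightarrow> expectation (\<lambda>\<omega>. (I \<omega>)\<^sup>2)"
    by (rule L2_limit(2)[OF m(2) Zm Zi P(3)])
  ultimately have isometry: "expectation (\<lambda>\<omega>. (I \<omega>)\<^sup>2) = (\<integral>r. (half_line f r)\<^sup>2 \<partial>lborel)"
    unfolding Ze using LIMSEQ_unique by blast
  show "centered_normal M I (\<integral>r. (half_line f r)\<^sup>2 \<partial>lborel)"
    using centered_normal_add_limit[of "\<lambda>_. 0" I ?Z 0, OF _ m(2) Zm Zi P(3)] Z
    by (simp add: isometry Ze)
  fix U v
  assume U: "centered_normal M U v"
    and ind: "\<And>P. step_list P \<Longrightarrow> indep_var borel U borel (step_integral W P)"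
  show "centered_normal M (\<lambda>\<omega>. U \<omega> + I \<omega>) (v + (\<integral>r. (half_line f r)\<^sup>2 \<partial>lborel))"
    unfolding isometry[symmetric]
  proof (rule centered_normal_add_limit[OF _ m(2) Zm Zi P(3)])
    show "centered_normal M (\<lambda>\<omega>. U \<omega> + ?Z n \<omega>) (v + expectation (\<lambda>\<omega>. (?Z n \<omega>)\<^sup>2))" for n
      unfolding Ze by (rule centered_normal_add_indep[OF ind[OF P(1)] U Z])
  qed (use U in \<open>auto simp: centered_normal_def\<close>)
qed

end

text \<open>Polarization of the isometry, which applies to \<open>I + J\<close> by linearity.\<close>

lemma (in prob_space) wiener_integral_covariance:
  assumes W: "standard_brownian_motion M W"
    and I: "has_wiener_integral M W f I" and J: "has_wiener_integral M W g J"
  shows "expectation (\<lambda>\<omega>. I \<omega> * J \<omega>) = (\<integral>r. half_line f r * half_line g r \<partial>lborel)"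
proof -
  have Wm: "0 \<le> t \<Longrightarrow> W t \<in> borel_measurable M" for t using W by (simp add: standard_brownian_motion_def)
  note IJ = has_wiener_integral_add[OF Wm I J]
  note v = centered_normal_imp_gaussian_rv(3,4)[OF wiener_integral_law(1)[OF W]]
  have m: "I \<in> borel_measurable M" "J \<in> borel_measurable M"
    "half_line f \<in> borel_measurable lborel" "half_line g \<in> borel_measurable lborel"
    using I J unfolding has_wiener_integral_iff by auto
  have sq: "integrable lborel (\<lambda>r. (half_line h r)\<^sup>2)" if "has_wiener_integral M W h L" for h L
  proof -
    have "(\<lambda>r. indicator {0..} r *\<^sub>R (h r)\<^sup>2) = (\<lambda>r. (half_line h r)\<^sup>2)"
      by (auto simp: half_line_def split: split_indicator)
    then show ?thesis using that by (simp add: has_wiener_integral_def set_integrable_def)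
  qed
  have "expectation (\<lambda>\<omega>. (I \<omega> + J \<omega>)\<^sup>2) = (\<integral>r. (half_line f r + half_line g r)\<^sup>2 \<partial>lborel)"
    using v(2)[OF IJ] by (simp add: half_line_def distrib_left)
  then show ?thesis
    unfolding integral_add_square[OF m(1,2) v(1)[OF I] v(1)[OF J]]
      integral_add_square[OF m(3,4) sq[OF I] sq[OF J]] v(2)[OF I] v(2)[OF J] by simp
qed

section \<open>Existence of the Wiener integral of a decreasing function\<close>

text \<open>The step function with mesh \<open>1 / m\<close> that takes on each cell the value of \<open>f\<close> at the right
  end point; for decreasing \<open>f\<close> it stays below \<open>f\<close>.\<close>

definition grid_steps :: "(real \<Rightarrow> real) \<Rightarrow> real \<Rightarrow> nat \<Rightarrow> (real \<times> real \<times> real) list" where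
  "grid_steps f m N = map (\<lambda>k. (real k / m, real (Suc k) / m, f (real (Suc k) / m))) [0..<N]"

lemma step_list_grid_steps: "0 < m \<Longrightarrow> step_list (grid_steps f m N)"
  by (auto simp: step_list_def grid_steps_def divide_right_mono)

lemma step_fun_grid_steps:
  assumes m: "0 < m" and r: "0 < r"
  shows "step_fun (grid_steps f m N) r
    = (if \<lceil>r * m\<rceil> \<le> int N then f (of_int \<lceil>r * m\<rceil> / m) else 0)"
proof -
  \<comment> \<open>The index of the only cell that contains \<open>r\<close>.\<close>
  define j where "j = nat (\<lceil>r * m\<rceil> - 1)"
  have pos: "0 < \<lceil>r * m\<rceil>" using m r by simp
  then have j: "int j = \<lceil>r * m\<rceil> - 1" by (simp add: j_def)
  then have j': "real (Suc j) = of_int \<lceil>r * m\<rceil>" by linarith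
  have ind: "indicator {real k / m<..real (Suc k) / m} r = (if k = j then 1 else 0 :: real)" for k
  proof -
    have "r \<in> {real k / m<..real (Suc k) / m} \<longleftrightarrow> real k < r * m \<and> r * m \<le> real k + 1"
      using m by (auto simp: field_simps)
    also have "\<dots> \<longleftrightarrow> \<lceil>r * m\<rceil> = int k + 1" by linarith
    also have "\<dots> \<longleftrightarrow> k = j" using j by auto
    finally show ?thesis by (simp add: indicator_def)
  qed
  have "step_fun (grid_steps f m N) r
      = (\<Sum>k<N. f (real (Suc k) / m) * indicator {real k / m<..real (Suc k) / m} r)"
    by (simp add: step_fun_def grid_steps_def comp_def interv_sum_list_conv_sum_set_nat atLeast0LessThan)
  also have "\<dots> = (\<Sum>k<N. if k = j then f (real (Suc j) / m) else 0)"
    by (intro sum.cong refl) (simp add: ind del: of_nat_Suc)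
  also have "\<dots> = (if j < N then f (of_int \<lceil>r * m\<rceil> / m) else 0)" by (simp add: j' del: of_nat_Suc)
  also have "j < N \<longleftrightarrow> \<lceil>r * m\<rceil> \<le> int N" using j by linarith
  finally show ?thesis .
qed

lemma grid_steps_tendsto:
  assumes f: "continuous_on {0<..} f" and r: "0 < r"
  shows "(\<lambda>n. step_fun (grid_steps f (real (Suc n)) (Suc n * Suc n)) r) \<longlonglongrightarrow> f r"
proof -
  \<comment> \<open>\<open>?q n\<close> is the right end point of the cell that contains \<open>r\<close>; it exceeds \<open>r\<close> by at most the mesh.\<close>
  let ?q = "\<lambda>n. of_int \<lceil>r * real (Suc n)\<rceil> / real (Suc n)"
  have q: "?q \<longlonglongrightarrow> r"
  proof (rule tendsto_sandwich)
    show "\<forall>\<^sub>F n in sequentially. r \<le> ?q n"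
      by (intro always_eventually allI) (simp add: pos_le_divide_eq)
    show "\<forall>\<^sub>F n in sequentially. ?q n \<le> r + 1 / real (Suc n)"
    proof (intro always_eventually allI)
      fix n
      have "of_int \<lceil>r * real (Suc n)\<rceil> \<le> r * real (Suc n) + 1" by linarith
      then have "?q n \<le> (r * real (Suc n) + 1) / real (Suc n)" by (rule divide_right_mono) simp
      also have "\<dots> = r + 1 / real (Suc n)" by (simp add: add_divide_distrib del: of_nat_Suc)
      finally show "?q n \<le> r + 1 / real (Suc n)" .
    qed
    show "(\<lambda>n. r + 1 / real (Suc n)) \<longlonglongrightarrow> r"
      using tendsto_add[OF tendsto_const LIMSEQ_inverse_real_of_nat, of r] by (simp add: inverse_eq_divide)
  qed simp
  have "isCont f r" using f r by (simp add: continuous_on_eq_continuous_at)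
  then have lim: "(\<lambda>n. f (?q n)) \<longlonglongrightarrow> f r" by (rule isCont_tendsto_compose[OF _ q])
  have ev: "\<forall>\<^sub>F n in sequentially. f (?q n) = step_fun (grid_steps f (real (Suc n)) (Suc n * Suc n)) r"
    using eventually_ge_at_top[of "nat \<lceil>r\<rceil>"]
  proof eventually_elim
    case (elim n)
    then have "r \<le> real (Suc n)" by linarith
    then have "r * real (Suc n) \<le> real (Suc n) * real (Suc n)" by (intro mult_right_mono) auto
    then have "\<lceil>r * real (Suc n)\<rceil> \<le> int (Suc n * Suc n)" by (simp only: ceiling_le_iff of_int_of_nat_eq of_int_mult of_nat_mult)
    then show ?case using step_fun_grid_steps[of "real (Suc n)" r f "Suc n * Suc n"] r by simp
  qed
  show ?thesis by (rule Lim_transform_eventually[OF lim ev])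
qed

text \<open>For a decreasing function the lower step functions are dominated by the function itself,
  even if it is unbounded near \<open>0\<close>, so pointwise convergence suffices.\<close>

lemma step_fun_L2_approx_decreasing:
  assumes [measurable]: "half_line f \<in> borel_measurable lborel"
    and sq: "integrable lborel (\<lambda>r. (half_line f r)\<^sup>2)"
    and nonneg: "\<And>r. 0 < r \<Longrightarrow> 0 \<le> f r"
    and decr: "\<And>r s. 0 < r \<Longrightarrow> r \<le> s \<Longrightarrow> f s \<le> f r"
    and cont: "continuous_on {0<..} f"
  obtains P where "\<And>n. step_list (P n)"
    "(\<lambda>n. \<integral>\<^sup>+ r. ennreal ((half_line f r - step_fun (P n) r)\<^sup>2) \<partial>lborel) \<longlonglongrightarrow> 0"
proof
  let ?P = "\<lambda>n. grid_steps f (real (Suc n)) (Suc n * Suc n)"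
  show P: "step_list (?P n)" for n by (rule step_list_grid_steps) simp
  have nz: "AE r in lborel. r \<noteq> (0::real)" by (rule AE_lborel_singleton)
  have "(\<lambda>n. \<integral>\<^sup>+ r. ennreal ((half_line f r - step_fun (?P n) r)\<^sup>2) \<partial>lborel)
      \<longlonglongrightarrow> (\<integral>\<^sup>+ r. 0 \<partial>(lborel :: real measure))"
  proof (rule nn_integral_dominated_convergence[where w = "\<lambda>r. ennreal ((half_line f r)\<^sup>2)"])
    show "(\<integral>\<^sup>+ r. ennreal ((half_line f r)\<^sup>2) \<partial>lborel) < \<infinity>"
      using sq by (simp add: nn_integral_eq_integral)
    show "AE r in lborel. ennreal ((half_line f r - step_fun (?P n) r)\<^sup>2) \<le> ennreal ((half_line f r)\<^sup>2)" for n
      using nz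
    proof eventually_elim
      case (elim r)
      show ?case
      proof (cases "0 < r")
        case True
        have "r \<le> of_int \<lceil>r * real (Suc n)\<rceil> / real (Suc n)" by (simp add: pos_le_divide_eq)
        then have "0 \<le> step_fun (?P n) r \<and> step_fun (?P n) r \<le> f r"
          using True step_fun_grid_steps[of "real (Suc n)" r f "Suc n * Suc n"] nonneg decr
          by (auto simp: less_le_trans)
        then show ?thesis using True by (intro ennreal_leI power_mono) (auto simp: half_line_def)
      next
        case False
        then show ?thesis using step_fun_nonpos[OF P[of n], of r] by simp
      qed
    qed
    show "AE r in lborel. (\<lambda>n. ennreal ((half_line f r - step_fun (?P n) r)\<^sup>2)) \<longlonglongrightarrow> 0"
      using nz
    proof eventually_elim
      case (elim r)
      have "(\<lambda>n. step_fun (?P n) r) \<longlonglongrightarrow> half_line f r"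
      proof (cases "0 < r")
        case True
        then show ?thesis using grid_steps_tendsto[OF cont True] by (simp add: half_line_def)
      next
        case False
        then show ?thesis using step_fun_nonpos[OF P, of r] elim by (simp add: half_line_def)
      qed
      then have "(\<lambda>n. ennreal ((half_line f r - step_fun (?P n) r)\<^sup>2)) \<longlonglongrightarrow> ennreal ((half_line f r - half_line f r)\<^sup>2)"
        by (intro tendsto_intros)
      then show ?case by simp
    qed
  qed auto
  then show "(\<lambda>n. \<integral>\<^sup>+ r. ennreal ((half_line f r - step_fun (?P n) r)\<^sup>2) \<partial>lborel) \<longlonglongrightarrow> 0" by simp
qed

lemma rapid_subsequence:
  fixes e :: "nat \<Rightarrow> ennreal"
  assumes "e \<longlonglongrightarrow> 0"
  obtains \<phi> where "\<And>n. e (\<phi> n) \<le> ennreal ((1 / 4) ^ n)"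
proof -
  have "\<exists>k. e k \<le> ennreal ((1 / 4) ^ n)" for n
    using order_tendstoD(2)[OF assms, of "ennreal ((1 / 4) ^ n)"] eventually_happens[of _ sequentially]
    by (force intro: less_imp_le)
  then show ?thesis using that by metis
qed

text \<open>Along a subsequence that approximates \<open>f\<close> at the rate \<open>1 / 4 ^ n\<close>, the isometry applied to
  differences of step functions makes the step integrals Cauchy at the same rate.\<close>

lemma (in prob_space) has_wiener_integral_exists:
  assumes W: "standard_brownian_motion M W"
    and f[measurable]: "half_line f \<in> borel_measurable lborel"
    and P: "\<And>n. step_list (P n)"
    and lim: "(\<lambda>n. \<integral>\<^sup>+ r. ennreal ((half_line f r - step_fun (P n) r)\<^sup>2) \<partial>lborel) \<longlonglongrightarrow> 0"
  shows "\<exists>I. has_wiener_integral M W f I"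
proof -
  obtain \<phi> where \<phi>: "\<And>n. (\<integral>\<^sup>+ r. ennreal ((half_line f r - step_fun (P (\<phi> n)) r)\<^sup>2) \<partial>lborel) \<le> ennreal ((1 / 4) ^ n)"
    using rapid_subsequence[OF lim] by blast
  define Q where "Q n = P (\<phi> n)" for n
  let ?e = "\<lambda>n. \<integral>\<^sup>+ r. ennreal ((half_line f r - step_fun (Q n) r)\<^sup>2) \<partial>lborel"
  have Q: "step_list (Q n)" and e: "?e n \<le> ennreal ((1 / 4) ^ n)" for n
    using P \<phi> by (auto simp: Q_def)
  have Wm: "0 \<le> t \<Longrightarrow> W t \<in> borel_measurable M" for t using W by (simp add: standard_brownian_motion_def)
  note Zm[measurable] = step_integral_measurable[OF Wm Q]
  have "(\<integral>\<^sup>+\<omega>. ennreal ((step_integral W (Q m) \<omega> - step_integral W (Q n) \<omega>)\<^sup>2) \<partial>M) \<le> ennreal (4 * (1 / 4) ^ n)"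
    if "n \<le> m" for n m
  proof -
    let ?D = "Q m @ scale_steps (- 1) (Q n)"
    have D: "step_list ?D" using Q by simp
    note N = centered_normal_imp_gaussian_rv[OF centered_normal_step_integral[OF W D]]
    have "(\<integral>\<^sup>+\<omega>. ennreal ((step_integral W (Q m) \<omega> - step_integral W (Q n) \<omega>)\<^sup>2) \<partial>M)
        = (\<integral>\<^sup>+\<omega>. ennreal ((step_integral W ?D \<omega>)\<^sup>2) \<partial>M)" by simp
    also have "\<dots> = (\<integral>\<^sup>+r. ennreal ((step_fun ?D r)\<^sup>2) \<partial>lborel)"
      unfolding nn_integral_eq_integral[OF N(3) AE_I2[OF zero_le_power2]] N(4)
      by (rule nn_integral_eq_integral[symmetric]) (use integrable_step_fun_square[OF D] in auto)
    also have "\<dots> \<le> (\<integral>\<^sup>+r. 2 * ennreal ((half_line f r - step_fun (Q m) r)\<^sup>2)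
        + 2 * ennreal ((half_line f r - step_fun (Q n) r)\<^sup>2) \<partial>lborel)"
    proof (rule nn_integral_mono)
      fix r
      have "0 \<le> ((half_line f r - step_fun (Q m) r) + (half_line f r - step_fun (Q n) r))\<^sup>2" by simp
      then have "(step_fun ?D r)\<^sup>2 \<le> 2 * (half_line f r - step_fun (Q m) r)\<^sup>2 + 2 * (half_line f r - step_fun (Q n) r)\<^sup>2"
        by (simp add: power2_eq_square algebra_simps)
      then have "ennreal ((step_fun ?D r)\<^sup>2)
          \<le> ennreal (2 * (half_line f r - step_fun (Q m) r)\<^sup>2 + 2 * (half_line f r - step_fun (Q n) r)\<^sup>2)"
        by (rule ennreal_leI)
      then show "ennreal ((step_fun ?D r)\<^sup>2) \<le> 2 * ennreal ((half_line f r - step_fun (Q m) r)\<^sup>2)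
        + 2 * ennreal ((half_line f r - step_fun (Q n) r)\<^sup>2)"
        by (simp add: ennreal_mult)
    qed
    also have "\<dots> = 2 * ?e m + 2 * ?e n" by (simp add: nn_integral_add nn_integral_cmult)
    also have "\<dots> \<le> 2 * ennreal ((1 / 4) ^ m) + 2 * ennreal ((1 / 4) ^ n)"
      by (intro add_mono mult_left_mono e) auto
    also have "\<dots> = ennreal (2 * (1 / 4) ^ m + 2 * (1 / 4) ^ n)" by (simp add: ennreal_mult)
    also have "\<dots> \<le> ennreal (4 * (1 / 4) ^ n)"
      using power_decreasing[OF that, of "1 / 4 :: real"] by (intro ennreal_leI) simp
    finally show ?thesis .
  qed
  then obtain I where I: "I \<in> borel_measurable M"
      "(\<lambda>n. \<integral>\<^sup>+\<omega>. ennreal ((I \<omega> - step_integral W (Q n) \<omega>)\<^sup>2) \<partial>M) \<longlonglongrightarrow> 0"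
    using L2_complete_geometric[of "\<lambda>n. step_integral W (Q n)" 4, OF Zm] by auto
  have "(\<lambda>n. ennreal ((1 / 4) ^ n)) \<longlonglongrightarrow> ennreal 0"
    by (intro tendsto_ennrealI LIMSEQ_realpow_zero) auto
  then have z: "(\<lambda>n. ennreal ((1 / 4) ^ n)) \<longlonglongrightarrow> 0" by simp
  have "?e \<longlonglongrightarrow> 0" by (rule tendsto_sandwich[OF _ _ tendsto_const z]) (auto simp: e)
  with I Q f show ?thesis unfolding has_wiener_integral_iff by blast
qed

section \<open>The kernel of the process\<close>

text \<open>The integrand that defines the process, with \<open>x\<close> in place of \<open>t powr (2 * H)\<close>.\<close>

definition kern :: "real \<Rightarrow> real \<Rightarrow> real \<Rightarrow> real" where
  "kern K x r = (1 - exp (- r * x)) * r powr (- ((1 + K) / 2))"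

text \<open>Asking for the derivative only inside the interval admits antiderivatives built from real
  powers, for which \<open>0\<close> is a boundary point.\<close>

lemma nn_integral_FTC_interior:
  fixes F f :: "real \<Rightarrow> real"
  assumes "a \<le> b" "continuous_on {a..b} F"
    and "\<And>x. a < x \<Longrightarrow> x < b \<Longrightarrow> (F has_real_derivative f x) (at x)"
    and "\<And>x. a \<le> x \<Longrightarrow> x \<le> b \<Longrightarrow> 0 \<le> f x"
  shows "(\<integral>\<^sup>+x. ennreal (f x) * indicator {a..b} x \<partial>lborel) = ennreal (F b - F a)"
proof (rule nn_integral_has_integral_lebesgue')
  show "(f has_integral F b - F a) {a..b}"
    using assms(1-3) by (intro fundamental_theorem_of_calculus_interior)
      (auto simp: has_real_derivative_iff_has_vector_derivative)
qed (use assms(4) in auto)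

lemma nn_integral_Gamma_scaled:
  assumes s: "0 < (s::real)" and w: "0 < w"
  shows "(\<integral>\<^sup>+r. ennreal (r powr (s - 1) * exp (- (r * w))) * indicator {0<..} r \<partial>lborel)
    = ennreal (Gamma s * w powr (- s))"
proof -
  have "(\<integral>\<^sup>+r. ennreal (r powr (s - 1) * exp (- (r * w))) * indicator {0<..} r \<partial>lborel)
      = (\<integral>\<^sup>+r. ennreal (w powr (1 - s)) * ennreal (indicator {0..} (w * r) * (w * r) powr (s - 1) / exp (w * r)) \<partial>lborel)"
  proof (intro nn_integral_cong)
    fix r :: real
    show "ennreal (r powr (s - 1) * exp (- (r * w))) * indicator {0<..} r
        = ennreal (w powr (1 - s)) * ennreal (indicator {0..} (w * r) * (w * r) powr (s - 1) / exp (w * r))"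
    proof (cases "0 < r")
      case True
      have "w powr (1 - s) * (w powr (s - 1)) = 1" using w by (simp add: powr_add[symmetric])
      with True w have "w powr (1 - s) * ((w * r) powr (s - 1) / exp (w * r)) = r powr (s - 1) * exp (- (r * w))"
        by (simp add: powr_mult exp_minus divide_inverse mult_ac)
      then show ?thesis using True w by (simp add: ennreal_mult[symmetric])
    next
      case False
      then show ?thesis using w by (cases "r = 0") (auto simp: zero_le_mult_iff indicator_def)
    qed
  qed
  also have "\<dots> = ennreal (w powr (1 - s)) * (\<integral>\<^sup>+r. ennreal (indicator {0..} (w * r) * (w * r) powr (s - 1) / exp (w * r)) \<partial>lborel)"
    by (rule nn_integral_cmult) simp
  also have "(\<integral>\<^sup>+r. ennreal (indicator {0..} (w * r) * (w * r) powr (s - 1) / exp (w * r)) \<partial>lborel) = ennreal (Gamma s / w)"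
  proof -
    have "ennreal (Gamma s) = ennreal w * (\<integral>\<^sup>+r. ennreal (indicator {0..} (w * r) * (w * r) powr (s - 1) / exp (w * r)) \<partial>lborel)"
      unfolding Gamma_conv_nn_integral_real[OF s]
      using nn_integral_real_affine[of "\<lambda>t. ennreal (indicator {0..} t * t powr (s - 1) / exp t)" w 0] w by simp
    then have "ennreal (1 / w) * ennreal (Gamma s) = ennreal (1 / w) * ennreal w * (\<integral>\<^sup>+r. ennreal (indicator {0..} (w * r) * (w * r) powr (s - 1) / exp (w * r)) \<partial>lborel)"
      by (simp add: mult.assoc)
    moreover have "ennreal (1 / w) * ennreal w = 1" using w by (simp add: ennreal_mult[symmetric])
    moreover have "ennreal (1 / w) * ennreal (Gamma s) = ennreal (Gamma s / w)"
      using w s by (simp add: ennreal_mult[symmetric] less_imp_le[OF Gamma_real_pos])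
    ultimately show ?thesis by simp
  qed
  also have "ennreal (w powr (1 - s)) * ennreal (Gamma s / w) = ennreal (Gamma s * w powr (- s))"
  proof -
    have "w powr (1 - s) / w = w powr (- s)" using w by (simp add: powr_diff powr_minus field_simps)
    then show ?thesis using w s
      by (subst ennreal_mult[symmetric]) (auto simp: less_imp_le[OF Gamma_real_pos] field_simps)
  qed
  finally show ?thesis .
qed

lemma nn_integral_powr_double:
  assumes K: "1 < K" "K < 2" and xy: "0 < x" "0 < (y::real)"
  shows "(\<integral>\<^sup>+u. (\<integral>\<^sup>+v. ennreal ((u + v) powr (K - 2)) * indicator {0..y} v \<partial>lborel) * indicator {0..x} u \<partial>lborel)
    = ennreal (((x + y) powr K - x powr K - y powr K) / (K * (K - 1)))"
proof -
  have inner: "(\<integral>\<^sup>+v. ennreal ((u + v) powr (K - 2)) * indicator {0..y} v \<partial>lborel)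
      = ennreal (((u + y) powr (K - 1) - u powr (K - 1)) / (K - 1))" if u: "0 < u" for u
  proof -
    have "(\<integral>\<^sup>+v. ennreal ((u + v) powr (K - 2)) * indicator {0..y} v \<partial>lborel)
        = ennreal ((u + y) powr (K - 1) / (K - 1) - (u + 0) powr (K - 1) / (K - 1))"
    proof (rule nn_integral_FTC_interior[where F = "\<lambda>v. (u + v) powr (K - 1) / (K - 1)"])
      show "continuous_on {0..y} (\<lambda>v. (u + v) powr (K - 1) / (K - 1))"
        using u K by (intro continuous_intros) auto
      show "((\<lambda>v. (u + v) powr (K - 1) / (K - 1)) has_real_derivative (u + v) powr (K - 2)) (at v)"
        if "0 < v" for v
        using u K that by (auto intro!: derivative_eq_intros)
    qed (use xy in auto)
    then show ?thesis by (simp add: diff_divide_distrib)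
  qed
  \<comment> \<open>The inner integral is evaluated only for \<open>u > 0\<close>, as its integrand is singular at \<open>v = 0\<close> when \<open>u = 0\<close>.\<close>
  have "(\<integral>\<^sup>+u. (\<integral>\<^sup>+v. ennreal ((u + v) powr (K - 2)) * indicator {0..y} v \<partial>lborel) * indicator {0..x} u \<partial>lborel)
      = (\<integral>\<^sup>+u. ennreal (((u + y) powr (K - 1) - u powr (K - 1)) / (K - 1)) * indicator {0..x} u \<partial>lborel)"
  proof (rule nn_integral_cong_AE)
    have "AE u in lborel. u \<noteq> (0::real)" by (rule AE_lborel_singleton)
    then show "AE u in lborel. (\<integral>\<^sup>+v. ennreal ((u + v) powr (K - 2)) * indicator {0..y} v \<partial>lborel) * indicator {0..x} u
        = ennreal (((u + y) powr (K - 1) - u powr (K - 1)) / (K - 1)) * indicator {0..x} u"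
      by eventually_elim (auto simp: inner indicator_def[of "{0..x}"])
  qed
  also have "\<dots> = ennreal (((x + y) powr K - x powr K) / (K * (K - 1)) - ((0 + y) powr K - 0 powr K) / (K * (K - 1)))"
  proof (rule nn_integral_FTC_interior[where F = "\<lambda>u. ((u + y) powr K - u powr K) / (K * (K - 1))"])
    show "continuous_on {0..x} (\<lambda>u. ((u + y) powr K - u powr K) / (K * (K - 1)))"
      using xy K by (intro continuous_intros continuous_on_powr') auto
    fix u :: real assume "0 < u"
    then have "((\<lambda>u. ((u + y) powr K - u powr K) / (K * (K - 1))) has_real_derivative
        (K * (u + y) powr (K - 1) - K * u powr (K - 1)) / (K * (K - 1))) (at u)"
      using xy K by (auto intro!: derivative_eq_intros)
    moreover have "(K * (u + y) powr (K - 1) - K * u powr (K - 1)) / (K * (K - 1))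
        = ((u + y) powr (K - 1) - u powr (K - 1)) / (K - 1)"
      using K by (simp add: right_diff_distrib[symmetric])
    ultimately show "((\<lambda>u. ((u + y) powr K - u powr K) / (K * (K - 1))) has_real_derivative
        ((u + y) powr (K - 1) - u powr (K - 1)) / (K - 1)) (at u)" by simp
  next
    fix u :: real assume "0 \<le> u"
    then show "0 \<le> ((u + y) powr (K - 1) - u powr (K - 1)) / (K - 1)"
      using xy K by (simp add: powr_mono2)
  qed (use xy in auto)
  also have "((x + y) powr K - x powr K) / (K * (K - 1)) - ((0 + y) powr K - 0 powr K) / (K * (K - 1))
      = ((x + y) powr K - x powr K - y powr K) / (K * (K - 1))"
    by (simp add: diff_divide_distrib)
  finally show ?thesis .
qed

lemma nn_integral_exp_segment:
  assumes "0 < r" "0 \<le> x"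
  shows "(\<integral>\<^sup>+u. ennreal (r * exp (- (r * u))) * indicator {0..x} u \<partial>lborel) = ennreal (1 - exp (- (r * x)))"
proof -
  have "(\<integral>\<^sup>+u. ennreal (r * exp (- (r * u))) * indicator {0..x} u \<partial>lborel)
      = ennreal (- exp (- (r * x)) - (- exp (- (r * 0))))"
    using assms by (intro nn_integral_FTC_interior continuous_intros)
      (auto intro!: derivative_eq_intros)
  then show ?thesis by simp
qed

text \<open>Tonelli's theorem for the positive function
  \<open>r powr (1 - K) * exp (- r (u + v))\<close>: integrating over \<open>u\<close> and \<open>v\<close> first gives the left side,
  integrating over \<open>r\<close> first gives \<open>\<Gamma>(2 - K) (u + v) powr (K - 2)\<close>, and then the right side.\<close>

lemma nn_integral_kern_mult:
  assumes K: "1 < K" "K < 2" and xy: "0 < x" "0 < (y::real)"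
  shows "(\<integral>\<^sup>+r. ennreal (kern K x r * kern K y r) * indicator {0<..} r \<partial>lborel)
    = ennreal (Gamma (2 - K) / (K * (K - 1)) * ((x + y) powr K - x powr K - y powr K))"
proof -
  define J :: "real \<Rightarrow> real \<Rightarrow> real \<Rightarrow> ennreal" where
    "J r u v = ennreal (r powr (1 - K) * exp (- (r * (u + v)))) * indicator {0<..} r
       * indicator {0..y} v * indicator {0..x} u" for r u v
  have Jm[measurable]: "(\<lambda>z. J (f z) (g z) (h z)) \<in> borel_measurable N"
    if [measurable]: "f \<in> borel_measurable N" "g \<in> borel_measurable N" "h \<in> borel_measurable N"
    for f g h and N :: "'z measure"
    unfolding J_def by measurable
  have r: "ennreal (kern K x r * kern K y r) * indicator {0<..} r = (\<integral>\<^sup>+u. \<integral>\<^sup>+v. J r u v \<partial>lborel \<partial>lborel)" for r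
  proof (cases "0 < r")
    case True
    have p: "r powr (- ((1 + K) / 2)) * r powr (- ((1 + K) / 2)) = r powr (- 1 - K)"
      using True by (simp add: powr_add[symmetric])
    have q: "r powr (- 1 - K) * (r * r) = r powr (1 - K)"
      using True powr_add[of r "- 1 - K" 2] by (simp add: power2_eq_square)
    have "kern K x r * kern K y r = (1 - exp (- (r * x))) * (1 - exp (- (r * y)))
        * (r powr (- ((1 + K) / 2)) * r powr (- ((1 + K) / 2)))"
      by (simp add: kern_def)
    then have "ennreal (kern K x r * kern K y r)
        = ennreal (r powr (- 1 - K)) * (ennreal (1 - exp (- (r * x))) * ennreal (1 - exp (- (r * y))))"
      unfolding p using True xy by (simp add: ennreal_mult[symmetric] mult_ac)
    also have "\<dots> = ennreal (r powr (- 1 - K)) * ((\<integral>\<^sup>+u. ennreal (r * exp (- (r * u))) * indicator {0..x} u \<partial>lborel)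
        * (\<integral>\<^sup>+v. ennreal (r * exp (- (r * v))) * indicator {0..y} v \<partial>lborel))"
      using True xy by (simp add: nn_integral_exp_segment)
    also have "\<dots> = (\<integral>\<^sup>+u. \<integral>\<^sup>+v. ennreal (r powr (- 1 - K)) * ((ennreal (r * exp (- (r * u))) * indicator {0..x} u)
        * (ennreal (r * exp (- (r * v))) * indicator {0..y} v)) \<partial>lborel \<partial>lborel)"
      by (simp add: nn_integral_cmult nn_integral_multc)
    also have "\<dots> = (\<integral>\<^sup>+u. \<integral>\<^sup>+v. J r u v \<partial>lborel \<partial>lborel)"
    proof (intro nn_integral_cong)
      fix u v
      have "r powr (- 1 - K) * ((r * exp (- (r * u))) * (r * exp (- (r * v))))
          = (r powr (- 1 - K) * (r * r)) * exp (- (r * (u + v)))"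
        by (simp add: distrib_left exp_add[symmetric] mult_ac)
      also have "\<dots> = r powr (1 - K) * exp (- (r * (u + v)))" unfolding q ..
      finally have "ennreal (r powr (- 1 - K)) * (ennreal (r * exp (- (r * u))) * ennreal (r * exp (- (r * v))))
          = ennreal (r powr (1 - K) * exp (- (r * (u + v))))"
        using True by (simp add: ennreal_mult[symmetric])
      then show "ennreal (r powr (- 1 - K)) * ((ennreal (r * exp (- (r * u))) * indicator {0..x} u)
        * (ennreal (r * exp (- (r * v))) * indicator {0..y} v)) = J r u v"
        using True by (simp add: J_def indicator_def)
    qed
    finally show ?thesis using True by simp
  qed (simp add: J_def)
  have "(\<integral>\<^sup>+r. ennreal (kern K x r * kern K y r) * indicator {0<..} r \<partial>lborel)
      = (\<integral>\<^sup>+r. \<integral>\<^sup>+u. \<integral>\<^sup>+v. J r u v \<partial>lborel \<partial>lborel \<partial>lborel)"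
    by (simp add: r)
  also have "\<dots> = (\<integral>\<^sup>+u. \<integral>\<^sup>+r. \<integral>\<^sup>+v. J r u v \<partial>lborel \<partial>lborel \<partial>lborel)"
    by (rule lborel_pair.Fubini') measurable
  also have "\<dots> = (\<integral>\<^sup>+u. \<integral>\<^sup>+v. \<integral>\<^sup>+r. J r u v \<partial>lborel \<partial>lborel \<partial>lborel)"
    by (intro nn_integral_cong lborel_pair.Fubini') measurable
  also have "\<dots> = (\<integral>\<^sup>+u. \<integral>\<^sup>+v. ennreal (Gamma (2 - K)) * (ennreal ((u + v) powr (K - 2)) * indicator {0..y} v * indicator {0..x} u) \<partial>lborel \<partial>lborel)"
  proof (rule nn_integral_cong, rule nn_integral_cong_AE)
    fix u :: real
    have "AE v in lborel. v \<noteq> (0::real)" by (rule AE_lborel_singleton)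
    then show "AE v in lborel. (\<integral>\<^sup>+r. J r u v \<partial>lborel)
        = ennreal (Gamma (2 - K)) * (ennreal ((u + v) powr (K - 2)) * indicator {0..y} v * indicator {0..x} u)"
    proof eventually_elim
      fix v :: real assume v: "v \<noteq> 0"
      \<comment> \<open>Excluding \<open>v = 0\<close> makes \<open>u + v\<close> positive, as the Gamma integral requires.\<close>
      show "(\<integral>\<^sup>+r. J r u v \<partial>lborel)
        = ennreal (Gamma (2 - K)) * (ennreal ((u + v) powr (K - 2)) * indicator {0..y} v * indicator {0..x} u)"
      proof (cases "v \<in> {0..y} \<and> u \<in> {0..x}")
        case True
        then show ?thesis
          using nn_integral_Gamma_scaled[of "2 - K" "u + v"] K v
          by (simp add: J_def ennreal_mult less_imp_le[OF Gamma_real_pos])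
      qed (auto simp: J_def)
    qed
  qed
  also have "\<dots> = ennreal (Gamma (2 - K)) *
      (\<integral>\<^sup>+u. (\<integral>\<^sup>+v. ennreal ((u + v) powr (K - 2)) * indicator {0..y} v \<partial>lborel) * indicator {0..x} u \<partial>lborel)"
    by (simp add: nn_integral_cmult nn_integral_multc)
  also have "\<dots> = ennreal (Gamma (2 - K)) * ennreal (((x + y) powr K - x powr K - y powr K) / (K * (K - 1)))"
    by (simp only: nn_integral_powr_double[OF K xy])
  also have "\<dots> = ennreal (Gamma (2 - K) * (((x + y) powr K - x powr K - y powr K) / (K * (K - 1))))"
    using K by (intro ennreal_mult'[symmetric]) (simp add: less_imp_le[OF Gamma_real_pos])
  finally show ?thesis by simp
qed

lemma powr_superadditive:
  assumes "1 \<le> K" "0 \<le> x" "0 \<le> (y::real)"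
  shows "x powr K + y powr K \<le> (x + y) powr K"
proof (cases "x + y = 0")
  case False
  have e: "z powr K = z * z powr (K - 1)" if "0 \<le> z" for z :: real
    using that powr_add[of z 1 "K - 1"] by (cases "z = 0") auto
  have "x * x powr (K - 1) + y * y powr (K - 1) \<le> x * (x + y) powr (K - 1) + y * (x + y) powr (K - 1)"
    using assms by (intro add_mono mult_left_mono powr_mono2) auto
  then show ?thesis using assms by (simp add: e distrib_right)
next
  case True
  then have "x = 0" "y = 0" using assms by auto
  then show ?thesis by simp
qed

lemma has_bochner_integral_kern_mult:
  assumes K: "1 < K" "K < 2" and xy: "0 \<le> x" "0 \<le> (y::real)"
  shows "has_bochner_integral lborel
    (\<lambda>r. (indicator {0..} r * kern K x r) * (indicator {0..} r * kern K y r))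
    (Gamma (2 - K) / (K * (K - 1)) * ((x + y) powr K - x powr K - y powr K))"
proof (cases "x = 0 \<or> y = 0")
  case True
  then show ?thesis using xy by (auto simp: kern_def)
next
  case False
  with xy have pos: "0 < x" "0 < y" by auto
  show ?thesis
  proof (rule has_bochner_integral_nn_integral)
    show "(\<lambda>r. (indicator {0..} r * kern K x r) * (indicator {0..} r * kern K y r)) \<in> borel_measurable lborel"
      unfolding kern_def by measurable
    show "AE r in lborel. 0 \<le> (indicator {0..} r * kern K x r) * (indicator {0..} r * kern K y r)"
      using pos by (intro AE_I2) (auto simp: kern_def indicator_def)
    show "0 \<le> Gamma (2 - K) / (K * (K - 1)) * ((x + y) powr K - x powr K - y powr K)"
      using K powr_superadditive[of K x y] pos by (simp add: less_imp_le[OF Gamma_real_pos])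
    have "(\<integral>\<^sup>+r. ennreal ((indicator {0..} r * kern K x r) * (indicator {0..} r * kern K y r)) \<partial>lborel)
        = (\<integral>\<^sup>+r. ennreal (kern K x r * kern K y r) * indicator {0<..} r \<partial>lborel)"
      by (intro nn_integral_cong) (auto simp: kern_def indicator_def)
    then show "(\<integral>\<^sup>+r. ennreal ((indicator {0..} r * kern K x r) * (indicator {0..} r * kern K y r)) \<partial>lborel)
        = ennreal (Gamma (2 - K) / (K * (K - 1)) * ((x + y) powr K - x powr K - y powr K))"
      using nn_integral_kern_mult[OF K pos] by simp
  qed
qed

lemma kern_nonneg: "0 \<le> x \<Longrightarrow> 0 \<le> r \<Longrightarrow> 0 \<le> kern K x r"
  by (simp add: kern_def)

text \<open>The kernel is the product of \<open>(1 - exp (- r x)) / r\<close> and a power of \<open>r\<close> with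
  nonpositive exponent. The former is a difference quotient at \<open>0\<close> of a concave function, hence
  decreasing; its derivative has the sign of \<open>exp (- r x) (1 + r x) - 1\<close>.\<close>

lemma kern_decreasing:
  assumes K: "1 \<le> K" and x: "0 \<le> x" and r: "0 < r" "r \<le> s"
  shows "kern K x s \<le> kern K x r"
proof -
  have "(1 - exp (- (s * x))) / s \<le> (1 - exp (- (r * x))) / r"
  proof (rule DERIV_nonpos_imp_nonincreasing[OF r(2)])
    fix q assume "r \<le> q" "q \<le> s"
    then have q: "0 < q" using r by simp
    have "((\<lambda>q. (1 - exp (- (q * x))) / q) has_real_derivative
        (exp (- (q * x)) * x * q - (1 - exp (- (q * x)))) / (q * q)) (at q)"
      using q by (auto intro!: derivative_eq_intros)
    moreover have "exp (- (q * x)) * (1 + q * x) \<le> exp (- (q * x)) * exp (q * x)"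
      using exp_ge_add_one_self[of "q * x"] by (intro mult_left_mono) auto
    then have "exp (- (q * x)) * x * q - (1 - exp (- (q * x))) \<le> 0"
      by (simp add: exp_minus field_simps)
    then have "(exp (- (q * x)) * x * q - (1 - exp (- (q * x)))) / (q * q) \<le> 0"
      using q by (simp add: divide_nonpos_pos)
    ultimately show "\<exists>y. ((\<lambda>q. (1 - exp (- (q * x))) / q) has_real_derivative y) (at q) \<and> y \<le> 0"
      by blast
  qed
  moreover have "s powr ((1 - K) / 2) \<le> r powr ((1 - K) / 2)"
    using r K by (intro powr_mono2') auto
  ultimately have "(1 - exp (- (s * x))) / s * s powr ((1 - K) / 2) \<le> (1 - exp (- (r * x))) / r * r powr ((1 - K) / 2)"
    using r x by (intro mult_mono) auto
  moreover have "kern K x q = (1 - exp (- (q * x))) / q * q powr ((1 - K) / 2)" if "0 < q" for q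
  proof -
    have "q powr ((1 - K) / 2) = q powr (1 + - ((1 + K) / 2))" by (simp add: field_simps)
    also have "\<dots> = q * q powr (- ((1 + K) / 2))" using that by (subst powr_add) simp
    finally show ?thesis using that by (simp add: kern_def)
  qed
  ultimately show ?thesis using r by simp
qed

lemma kern_continuous: "continuous_on {0<..} (kern K x)"
  unfolding kern_def by (intro continuous_intros) auto

text \<open>An integral exists, so the one picked by the choice operator is an integral.\<close>

lemma (in prob_space) has_wiener_integral_kern:
  assumes W: "standard_brownian_motion M W" and K: "1 < K" "K < 2" and x: "0 \<le> x"
  shows "has_wiener_integral M W (kern K x) (wiener_integral M W (kern K x))"
proof -
  have m: "half_line (kern K x) \<in> borel_measurable lborel"
    unfolding half_line_def[abs_def] kern_def by measurable
  have sq: "integrable lborel (\<lambda>r. (half_line (kern K x) r)\<^sup>2)"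
    using has_bochner_integral_kern_mult[OF K x x]
    by (simp add: half_line_def power2_eq_square has_bochner_integral_iff)
  have "\<exists>I. has_wiener_integral M W (kern K x) I"
    by (rule step_fun_L2_approx_decreasing[OF m sq])
      (use K x in \<open>auto intro: kern_nonneg kern_decreasing kern_continuous has_wiener_integral_exists[OF W m]\<close>)
  then show ?thesis unfolding wiener_integral_def by (rule someI_ex)
qed

section \<open>Adding an independent Gaussian process\<close>

text \<open>Both variables are measurable functions of the respective path, each reading only finitely
  many coordinates with nonnegative index.\<close>

lemma (in prob_space) indep_linear_functionals:
  assumes ind: "indep_processes M {0..} B W" and F: "finite F" "F \<subseteq> {0..}" and P: "step_list P"
  shows "indep_var borel (\<lambda>\<omega>. \<Sum>t\<in>F. c t * B t \<omega>) borel (step_integral W P)"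
proof -
  let ?g = "\<lambda>x :: real \<Rightarrow> real. \<Sum>t\<in>F. c t * x t"
  let ?h = "step_integral (\<lambda>t x. x t) P"
  have comp: "(\<lambda>x. x t) \<in> borel_measurable (PiM {0..} (\<lambda>_. borel :: real measure))" if "0 \<le> t" for t :: real
    using that by (intro measurable_component_singleton) auto
  have g: "?g \<in> borel_measurable (PiM {0..} (\<lambda>_. borel))"
    using F comp by (intro borel_measurable_sum borel_measurable_times) auto
  have h: "?h \<in> borel_measurable (PiM {0..} (\<lambda>_. borel))"
    by (rule step_integral_measurable[OF comp P])
  have "indep_var borel (?g \<circ> (\<lambda>\<omega>. \<lambda>t\<in>{0..}. B t \<omega>)) borel (?h \<circ> (\<lambda>\<omega>. \<lambda>t\<in>{0..}. W t \<omega>))"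
    by (rule indep_var_compose[OF ind[unfolded indep_processes_def] g h])
  moreover have "?g \<circ> (\<lambda>\<omega>. \<lambda>t\<in>{0..}. B t \<omega>) = (\<lambda>\<omega>. \<Sum>t\<in>F. c t * B t \<omega>)"
    using F by (intro ext) (auto simp: comp_def intro!: sum.cong)
  moreover have "?h \<circ> (\<lambda>\<omega>. \<lambda>t\<in>{0..}. W t \<omega>) = step_integral W P"
  proof
    show "(?h \<circ> (\<lambda>\<omega>. \<lambda>t\<in>{0..}. W t \<omega>)) \<omega> = step_integral W P \<omega>" for \<omega>
      using P by (induction P) (auto simp: comp_def)
  qed
  ultimately show ?thesis by simp
qed

lemma gaussian_rv_of_process:
  assumes "gaussian_process M T B" "t \<in> T"
  shows "gaussian_rv M (B t)"
  using assms(1)[unfolded gaussian_process_def, THEN spec[of _ "{t}"], THEN spec[of _ "\<lambda>_. 1"]] assms(2)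
  by simp

lemma (in prob_space) indep_gaussian_plus_wiener:
  assumes W: "standard_brownian_motion M W" and ind: "indep_processes M {0..} B W"
    and B: "centered_gaussian_process M {0..} B"
    and F: "finite F" "F \<subseteq> {0..}"
    and I: "has_wiener_integral M W f I"
  shows "centered_normal M (\<lambda>\<omega>. (\<Sum>t\<in>F. c t * B t \<omega>) + I \<omega>)
    (expectation (\<lambda>\<omega>. (\<Sum>t\<in>F. c t * B t \<omega>)\<^sup>2) + (\<integral>r. (half_line f r)\<^sup>2 \<partial>lborel))"
proof (rule wiener_integral_law(2)[OF W I])
  have G: "gaussian_rv M (\<lambda>\<omega>. \<Sum>t\<in>G. d t * B t \<omega>)" if "finite G" "G \<subseteq> {0..}" for G d
    using B that unfolding centered_gaussian_process_def gaussian_process_def by blast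
  have "gaussian_rv M (B t)" "expectation (B t) = 0" if "t \<in> F" for t
    using gaussian_rv_of_process[of M "{0..}" B t] B F that by (auto simp: centered_gaussian_process_def)
  then have "expectation (\<lambda>\<omega>. \<Sum>t\<in>F. c t * B t \<omega>) = (\<Sum>t\<in>F. c t * expectation (B t))"
    by (subst Bochner_Integration.integral_sum) (auto intro: gaussian_rv_imp_centered_normal(2))
  also have "\<dots> = 0" using B F by (auto simp: centered_gaussian_process_def intro!: sum.neutral)
  finally show "centered_normal M (\<lambda>\<omega>. \<Sum>t\<in>F. c t * B t \<omega>) (expectation (\<lambda>\<omega>. (\<Sum>t\<in>F. c t * B t \<omega>)\<^sup>2))"
    by (intro gaussian_rv_imp_centered_normal(1) G F)
  show "indep_var borel (\<lambda>\<omega>. \<Sum>t\<in>F. c t * B t \<omega>) borel (step_integral W P)" if "step_list P" for P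
    by (rule indep_linear_functionals[OF ind F that])
qed

theorem theorem2p3:
  fixes M :: "'a measure"
    and H K a b :: real
    and B W X :: "real \<Rightarrow> 'a \<Rightarrow> real"
  assumes "prob_space M"
    and "0 < H" "H < 1" "1 < K" "K < 2" "0 < H * K" "H * K < 1"
    and "fractional_brownian_motion M (H * K) B"
    and "standard_brownian_motion M W"
    and "indep_processes M {0..} B W"
    and "\<And>t. t \<ge> 0 \<Longrightarrow> X t \<in> borel_measurable M"
    and "\<And>t. t \<ge> 0 \<Longrightarrow> AE \<omega> in M. X t \<omega> =
           wiener_integral M W
             (\<lambda>r. (1 - exp (- r * t powr (2 * H))) * r powr (- ((1 + K) / 2))) \<omega>"
    and "a = sqrt (2 powr (1 - K))"
    and "b = sqrt (K * (K - 1) / (2 powr K * Gamma (2 - K)))"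
  shows "centered_gaussian_process M {0..} (\<lambda>t \<omega>. a * B t \<omega> + b * X t \<omega>) \<and>
    (\<forall>s\<ge>0. \<forall>t\<ge>0.
       (\<integral>\<omega>. (a * B t \<omega> + b * X t \<omega>) * (a * B s \<omega> + b * X s \<omega>) \<partial>M) =
         1 / 2 powr K * ((t powr (2 * H) + s powr (2 * H)) powr K - \<bar>t - s\<bar> powr (2 * H * K)))"
proof -
  interpret prob_space M by fact
  note W = assms(9) and ind = assms(10)
  have K: "1 < K" "K < 2" by fact+
  have B: "centered_gaussian_process M {0..} B"
    and Bcov: "\<And>s t. 0 \<le> s \<Longrightarrow> 0 \<le> t \<Longrightarrow> expectation (\<lambda>\<omega>. B t \<omega> * B s \<omega>) =
        1 / 2 * (t powr (2 * (H * K)) + s powr (2 * (H * K)) - \<bar>t - s\<bar> powr (2 * (H * K)))"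
    using assms(8) by (auto simp: fractional_brownian_motion_def)
  have Wm: "0 \<le> t \<Longrightarrow> W t \<in> borel_measurable M" for t
    using W by (simp add: standard_brownian_motion_def)
  define k where "k t = kern K (t powr (2 * H))" for t
  have X: "has_wiener_integral M W (k t) (X t)" if t: "0 \<le> t" for t
  proof -
    have wi: "has_wiener_integral M W (k t) (wiener_integral M W (k t))"
      unfolding k_def by (rule has_wiener_integral_kern[OF W K]) simp
    have ae: "AE \<omega> in M. X t \<omega> = wiener_integral M W (k t) \<omega>"
      using assms(12)[OF t] by (simp add: k_def kern_def[abs_def])
    have "(\<integral>\<^sup>+ \<omega>. ennreal ((X t \<omega> - step_integral W P \<omega>)\<^sup>2) \<partial>M)
        = (\<integral>\<^sup>+ \<omega>. ennreal ((wiener_integral M W (k t) \<omega> - step_integral W P \<omega>)\<^sup>2) \<partial>M)" for P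
      using ae by (intro nn_integral_cong_AE) auto
    then show ?thesis using wi assms(11)[OF t] by (simp add: has_wiener_integral_def)
  qed
  \<comment> \<open>A linear combination of the \<open>X t\<close> is again a Wiener integral, so one application covers all finite-dimensional laws.\<close>
  have normal: "centered_normal M (\<lambda>\<omega>. (\<Sum>t\<in>F. c t * B t \<omega>) + (\<Sum>t\<in>F. d t * X t \<omega>))
      (expectation (\<lambda>\<omega>. (\<Sum>t\<in>F. c t * B t \<omega>)\<^sup>2) + expectation (\<lambda>\<omega>. (\<Sum>t\<in>F. d t * X t \<omega>)\<^sup>2))"
    if F: "finite F" "F \<subseteq> {0..}" for F c d
  proof -
    have "has_wiener_integral M W (\<lambda>r. \<Sum>t\<in>F. d t * k t r) (\<lambda>\<omega>. \<Sum>t\<in>F. d t * X t \<omega>)"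
      using F by (intro has_wiener_integral_sum Wm X) auto
    from indep_gaussian_plus_wiener[OF W ind B F this]
      centered_normal_imp_gaussian_rv(4)[OF wiener_integral_law(1)[OF W this]]
    show ?thesis by simp
  qed
  have lin: "gaussian_rv M (\<lambda>\<omega>. \<Sum>t\<in>F. c t * (a * B t \<omega> + b * X t \<omega>))"
    "expectation (\<lambda>\<omega>. \<Sum>t\<in>F. c t * (a * B t \<omega> + b * X t \<omega>)) = 0"
    if F: "finite F" "F \<subseteq> {0..}" for F c
    using centered_normal_imp_gaussian_rv(1,2)[OF normal[OF F, of "\<lambda>t. c t * a" "\<lambda>t. c t * b"]]
    by (simp_all add: sum.distrib distrib_left mult.assoc)
  have "centered_gaussian_process M {0..} (\<lambda>t \<omega>. a * B t \<omega> + b * X t \<omega>)"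
    unfolding centered_gaussian_process_def gaussian_process_def
    using lin(1) lin(2)[of "{t}" "\<lambda>_. 1" for t] by auto
  moreover have "expectation (\<lambda>\<omega>. (a * B t \<omega> + b * X t \<omega>) * (a * B s \<omega> + b * X s \<omega>)) =
         1 / 2 powr K * ((t powr (2 * H) + s powr (2 * H)) powr K - \<bar>t - s\<bar> powr (2 * H * K))"
    if st: "0 \<le> s" "0 \<le> t" for s t
  proof -
    have Bg: "gaussian_rv M (B t)" "expectation (B t) = 0" if "0 \<le> t" for t
      using B that gaussian_rv_of_process[of M "{0..}" B t] by (auto simp: centered_gaussian_process_def)
    have Bm: "B t \<in> borel_measurable M" and Bi: "integrable M (\<lambda>\<omega>. (B t \<omega>)\<^sup>2)" if "0 \<le> t" for t
      using Bg[OF that] gaussian_rv_imp_centered_normal(3) by (auto simp: gaussian_rv_def)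
    have Xi: "integrable M (\<lambda>\<omega>. (X t \<omega>)\<^sup>2)" if "0 \<le> t" for t
      by (rule centered_normal_imp_gaussian_rv(3)[OF wiener_integral_law(1)[OF W X[OF that]]])
    note Xm = assms(11)
    \<comment> \<open>By independence the variance of \<open>B t + X s\<close> is the sum of the variances, so the cross moment vanishes.\<close>
    have BX: "expectation (\<lambda>\<omega>. B t \<omega> * X s \<omega>) = 0" if "0 \<le> t" "0 \<le> s" for s t
    proof -
      have "expectation (\<lambda>\<omega>. (B t \<omega> + X s \<omega>)\<^sup>2) = expectation (\<lambda>\<omega>. (B t \<omega>)\<^sup>2) + expectation (\<lambda>\<omega>. (X s \<omega>)\<^sup>2)"
        using centered_normal_imp_gaussian_rv(4)[OF indep_gaussian_plus_wiener[OF W ind B, of "{t}" _ _ "\<lambda>_. 1", OF _ _ X[of s]]]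
          centered_normal_imp_gaussian_rv(4)[OF wiener_integral_law(1)[OF W X[of s]]] that
        by simp
      then show ?thesis
        using integral_add_square[OF Bm Xm Bi Xi] that by simp
    qed
    have XX: "expectation (\<lambda>\<omega>. X t \<omega> * X s \<omega>) = Gamma (2 - K) / (K * (K - 1)) *
        ((t powr (2 * H) + s powr (2 * H)) powr K - (t powr (2 * H)) powr K - (s powr (2 * H)) powr K)"
      using wiener_integral_covariance[OF W X[OF st(2)] X[OF st(1)]]
        has_bochner_integral_kern_mult[OF K, of "t powr (2 * H)" "s powr (2 * H)"]
      by (simp add: k_def half_line_def has_bochner_integral_iff)
    have "expectation (\<lambda>\<omega>. (a * B t \<omega> + b * X t \<omega>) * (a * B s \<omega> + b * X s \<omega>))
        = expectation (\<lambda>\<omega>. a\<^sup>2 * (B t \<omega> * B s \<omega>) + a * b * (B t \<omega> * X s \<omega>) + a * b * (B s \<omega> * X t \<omega>)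
            + b\<^sup>2 * (X t \<omega> * X s \<omega>))"
      by (rule Bochner_Integration.integral_cong) (auto simp: power2_eq_square algebra_simps)
    also have "\<dots> = a\<^sup>2 * expectation (\<lambda>\<omega>. B t \<omega> * B s \<omega>) + a * b * expectation (\<lambda>\<omega>. B t \<omega> * X s \<omega>)
        + a * b * expectation (\<lambda>\<omega>. B s \<omega> * X t \<omega>) + b\<^sup>2 * expectation (\<lambda>\<omega>. X t \<omega> * X s \<omega>)"
      using st by (simp add: integral_mult_le_sqrt(1) Bm Bi Xm Xi)
    also have "\<dots> = a\<^sup>2 * expectation (\<lambda>\<omega>. B t \<omega> * B s \<omega>) + b\<^sup>2 * expectation (\<lambda>\<omega>. X t \<omega> * X s \<omega>)"
      using st by (simp add: BX)
    also have "a\<^sup>2 * expectation (\<lambda>\<omega>. B t \<omega> * B s \<omega>)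
        = 1 / 2 powr K * (t powr (2 * H * K) + s powr (2 * H * K) - \<bar>t - s\<bar> powr (2 * H * K))"
      using st by (simp add: Bcov assms(13) powr_diff mult.assoc diff_divide_distrib add_divide_distrib)
    also have "b\<^sup>2 * expectation (\<lambda>\<omega>. X t \<omega> * X s \<omega>)
        = 1 / 2 powr K * ((t powr (2 * H) + s powr (2 * H)) powr K - t powr (2 * H * K) - s powr (2 * H * K))"
    proof -
      have G: "0 < Gamma (2 - K)" using K by (simp add: Gamma_real_pos)
      then have G0: "Gamma (2 - K) \<noteq> 0" by simp
      from G have "b\<^sup>2 = K * (K - 1) / (2 powr K * Gamma (2 - K))" using K by (simp add: assms(14))
      then have "b\<^sup>2 * (Gamma (2 - K) / (K * (K - 1)) * z) = 1 / 2 powr K * z" for z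
        using G0 K by simp
      then show ?thesis unfolding XX by (simp add: powr_powr)
    qed
    finally show ?thesis by (simp add: algebra_simps)
  qed
  ultimately show ?thesis by blast
qed

end
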